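(* Let $K$ be an algebraically closed field and let $\Lambda=K\mathcal{Q}/I$ be the Brauer configuration algebra associated to a Brauer configuration $\Gamma=(\Gamma_0,\Gamma_1,\mu,\mathfrak{o})$. If $\mathcal{C}_\Lambda=(c_{v,w})_{V,W\in\Gamma_1}$ is the Cartan matrix of $\Lambda$, then $$c_{v,w}=\begin{cases}2+\displaystyle\sum_{\alpha\in\overline{V}}\mathrm{occ}(\alpha,V)\bigl(\mathrm{occ}(\alpha,V)\mu(\alpha)-1\bigr), & V=W;\\[2mm] \displaystyle\sum_{\alpha\in\overline{V}\cap\overline{W}}\mu(\alpha)\,\mathrm{occ}(\alpha,V)\,\mathrm{occ}(\alpha,W), & V\neq W.\end{cases}$$
   Context: Cartan matrix: for a basic finite dimensional $K$-algebra $\Lambda$ with complete set $\{e_1,\dots,e_n\}$ of primitive orthogonal idempotents, it is the matrix $(c_{ij})$ with $c_{ij}=\dim_K e_j\Lambda e_i$. Here the idempotents are the (classes of the) vertices $v$ of $\mathcal{Q}$, indexed by the polygons $V\in\Gamma_1$, so $c_{v,w}=\dim_K w\Lambda v$. Brauer configurations. A Brauer configuration is a quadruple $\Gamma=(\Gamma_0,\Gamma_1,\mu,\mathfrak{o})$ where: $\Gamma_0$ is a finite set (vertices); $\Gamma_1$ is a finite collection of finite labeled multisets of elements of $\Gamma_0$ (polygons; differently labeled polygons may have the same elements); $\mu:\Gamma_0\to\mathbb{Z}_{>0}$ is a function (multiplicity). For $\alpha\in\Gamma_0$, $V\in\Gamma_1$, $\mathrm{occ}(\alpha,V)$ is the number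 of times $\alpha$ occurs in $V$, and $\mathrm{val}(\alpha)=\sum_{V\in\Gamma_1}\mathrm{occ}(\alpha,V)$. A vertex $\alpha$ is truncated if $\mathrm{val}(\alpha)=\mu(\alpha)=1$. The orientation $\mathfrak{o}$ is a choice, for each nontruncated vertex $\alpha$, of a cyclic ordering $V_{i_1}<\cdots<V_{i_t}(<V_{i_1})$, $t=\mathrm{val}(\alpha)$, of the list of polygons containing $\alpha$, in which each $V$ appears $\mathrm{occ}(\alpha,V)$ times (the successor sequence at $\alpha$). It is required that: (C1) every vertex occurs in at least one polygon; (C2) every polygon has at least two vertices (counted with repetition); (C3) every polygon contains a vertex $\alpha$ with $\mathrm{val}(\alpha)\mu(\alpha)>1$. $\overline{V}$ denotes the set of vertices occurring in $V$. Quiver and algebra. The quiver $\mathcal{Q}$ induced by $\Gamma$ has one vertex $v$ for each polygon $V$ (and $w$ for $W$), and for each nontruncated $\alpha$ with successor sequence $V_{i_1}<\cdots<V_{i_t}$ it has $t$ arrows $a^{(\alpha)}_j:v_{i_j}\to v_{i_{j+1}}$ ($1\le j\le t$, $i_{t+1}=i_1$), all arrows for different $\alpha$ or different $j$ being distinct. Paths are written from left to right. The special $\alpha$-cycles are $C_l=a^{(\alpha)}_l\cdots a^{(\alpha)}_t a^{(\alpha)}_1\cdots a^{(\alpha)}_{l-1}$, $1\le l\le t$; those starting (and ending) at $v$ are the special $\alpha$-cycles at $v$. The Brauer configuration algebra is $\Lambda=K\mathcal{Q}/I$ where $I$ is generated by: (type one) $C^{\mu(\alpha)}-D^{\mu(\beta)}$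 for every polygon $V$, all nontruncated $\alpha,\beta\in\overline{V}$, and all special $\alpha$-cycles $C$ and special $\beta$-cycles $D$ at $v$; (type two) $C^{\mu(\alpha)}f(C)$ for every nontruncated $\alpha$ and special $\alpha$-cycle $C$, where $f(C)$ is the first arrow of $C$; (type three) all paths $ab$ of length two that are not subpaths of any special cycle, except the squares $aa$ where $a$ is the loop induced by a vertex $\alpha$ with $\mathrm{val}(\alpha)=1$ and $\mu(\alpha)>1$. *)

theory Defs
  imports
    "HOL-Library.Multiset"
    "HOL-Library.Sublist"
    "HOL-Computational_Algebra.Polynomial"
    "HOL-Algebra.QuotRing"
    "HOL-Algebra.Embedded_Algebras"
    "Graph_Theory.Arc_Walk"
begin

section \<open>Path algebras\<close>

text \<open>
  A quiver is a \<^typ>\<open>('v, 'e) pre_digraph\<close>. A path is a start vertex together with a list of arrows,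
  composed from left to right; \<open>(v, [])\<close> is the trivial path at \<open>v\<close>.
\<close>

definition paths :: "('v, 'e) pre_digraph \<Rightarrow> ('v \<times> 'e list) set" where
  "paths Q = {(u, p). \<exists>v. pre_digraph.awalk Q u p v}"

text \<open>
  The elements of the path algebra are the finitely supported families of coefficients on the paths.
  The coefficient of a path in a product is the sum over all its factorisations into two paths.
  The coefficient field is the type \<open>'k\<close>; the first argument only carries this type.
\<close>

definition path_algebra ::
    "'k itself \<Rightarrow> ('v, 'e) pre_digraph \<Rightarrow> ('v \<times> 'e list \<Rightarrow> 'k :: field) ring" where
  "path_algebra K Q = \<lparr>
     carrier = {f. finite {x. f x \<noteq> 0} \<and> {x. f x \<noteq> 0} \<subseteq> paths Q},
     monoid.mult = (\<lambda>f g (u, p). \<Sum>i\<le>length p.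
       f (u, take i p) * g (pre_digraph.awlast Q u (take i p), drop i p)),
     one = (\<lambda>(u, p). if u \<in> verts Q \<and> p = [] then 1 else 0),
     ring.zero = (\<lambda>_. 0),
     add = (\<lambda>f g x. f x + g x)\<rparr>"

definition path_elem :: "'k itself \<Rightarrow> 'v \<times> 'e list \<Rightarrow> ('v \<times> 'e list \<Rightarrow> 'k :: field)" where
  "path_elem K x = (\<lambda>y. if y = x then 1 else 0)"

text \<open>
  The copy \<open>K \<cdot> 1\<close> of the ground field in the path algebra; it is central, so that multiplication
  by it is the \<open>K\<close>-vector space structure.
\<close>

definition path_scalars ::
    "'k itself \<Rightarrow> ('v, 'e) pre_digraph \<Rightarrow> ('v \<times> 'e list \<Rightarrow> 'k :: field) set" where
  "path_scalars K Q = range (\<lambda>c x. c * \<one>\<^bsub>path_algebra K Q\<^esub> x)"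


section \<open>Cartan matrices\<close>

text \<open>
  The entry \<open>c\<^sub>i\<^sub>j = dim\<^sub>K (e\<^sub>j \<Lambda> e\<^sub>i)\<close>, where the ground field is given as its copy \<open>F\<close> inside \<open>\<Lambda>\<close> and
  \<open>e\<close> is the family of primitive orthogonal idempotents.
\<close>

definition cartan_matrix ::
    "('r, 'm) ring_scheme \<Rightarrow> 'r set \<Rightarrow> ('i \<Rightarrow> 'r) \<Rightarrow> 'i \<Rightarrow> 'i \<Rightarrow> nat" where
  "cartan_matrix \<Lambda> F e i j =
     ring.dim \<Lambda> F {e j \<otimes>\<^bsub>\<Lambda>\<^esub> x \<otimes>\<^bsub>\<Lambda>\<^esub> e i | x. x \<in> carrier \<Lambda>}"


section \<open>Brauer configurations\<close>

text \<open>
  Polygons are labels of type \<open>'p\<close>, each with a multiset of vertices, so that different polygons may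
  have the same vertices. The cyclic ordering at \<open>\<alpha>\<close> is given by a list \<open>bc_succ \<Gamma> \<alpha>\<close> which
  represents it (one starting point of the successor sequence is chosen); only its values at
  nontruncated vertices matter.
\<close>

record ('a, 'p) brauer_config =
  bc_vertices :: "'a set"
  bc_polygons :: "'p set"
  bc_mset :: "'p \<Rightarrow> 'a multiset"
  bc_mult :: "'a \<Rightarrow> nat"
  bc_succ :: "'a \<Rightarrow> 'p list"

definition occ :: "('a, 'p) brauer_config \<Rightarrow> 'a \<Rightarrow> 'p \<Rightarrow> nat" where
  "occ \<Gamma> \<alpha> V = count (bc_mset \<Gamma> V) \<alpha>"

definition val :: "('a, 'p) brauer_config \<Rightarrow> 'a \<Rightarrow> nat" where
  "val \<Gamma> \<alpha> = (\<Sum>V\<in>bc_polygons \<Gamma>. occ \<Gamma> \<alpha> V)"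

definition truncated :: "('a, 'p) brauer_config \<Rightarrow> 'a \<Rightarrow> bool" where
  "truncated \<Gamma> \<alpha> \<longleftrightarrow> val \<Gamma> \<alpha> = 1 \<and> bc_mult \<Gamma> \<alpha> = 1"

abbreviation polygon_vertices :: "('a, 'p) brauer_config \<Rightarrow> 'p \<Rightarrow> 'a set" where
  "polygon_vertices \<Gamma> V \<equiv> set_mset (bc_mset \<Gamma> V)"

locale brauer_configuration =
  fixes \<Gamma> :: "('a, 'p) brauer_config"
  assumes finite_vertices: "finite (bc_vertices \<Gamma>)"
    and finite_polygons: "finite (bc_polygons \<Gamma>)"
    and polygon_vertices_subset:
      "V \<in> bc_polygons \<Gamma> \<Longrightarrow> polygon_vertices \<Gamma> V \<subseteq> bc_vertices \<Gamma>"
    and mult_pos: "\<alpha> \<in> bc_vertices \<Gamma> \<Longrightarrow> bc_mult \<Gamma> \<alpha> > 0"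
    and orientation:
      "\<lbrakk>\<alpha> \<in> bc_vertices \<Gamma>; \<not> truncated \<Gamma> \<alpha>\<rbrakk> \<Longrightarrow>
        count (mset (bc_succ \<Gamma> \<alpha>)) V = (if V \<in> bc_polygons \<Gamma> then occ \<Gamma> \<alpha> V else 0)"
    and vertex_in_polygon:
      "\<alpha> \<in> bc_vertices \<Gamma> \<Longrightarrow> \<exists>V\<in>bc_polygons \<Gamma>. \<alpha> \<in> polygon_vertices \<Gamma> V"
    and polygon_size: "V \<in> bc_polygons \<Gamma> \<Longrightarrow> size (bc_mset \<Gamma> V) \<ge> 2"
    and polygon_nontruncated:
      "V \<in> bc_polygons \<Gamma> \<Longrightarrow> \<exists>\<alpha>\<in>polygon_vertices \<Gamma> V. val \<Gamma> \<alpha> * bc_mult \<Gamma> \<alpha> > 1"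


section \<open>Brauer configuration algebras\<close>

text \<open>
  The arrow \<open>(\<alpha>, j)\<close> leads from the entry \<open>j\<close> of the successor sequence at \<open>\<alpha>\<close> to the cyclically
  next one; positions are counted from \<open>0\<close>.
\<close>

definition bc_quiver :: "('a, 'p) brauer_config \<Rightarrow> ('p, 'a \<times> nat) pre_digraph" where
  "bc_quiver \<Gamma> = \<lparr>
     verts = bc_polygons \<Gamma>,
     arcs = {(\<alpha>, j). \<alpha> \<in> bc_vertices \<Gamma> \<and> \<not> truncated \<Gamma> \<alpha> \<and> j < val \<Gamma> \<alpha>},
     tail = (\<lambda>(\<alpha>, j). bc_succ \<Gamma> \<alpha> ! j),
     head = (\<lambda>(\<alpha>, j). bc_succ \<Gamma> \<alpha> ! (Suc j mod val \<Gamma> \<alpha>))\<rparr>"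

definition nontruncated_in :: "('a, 'p) brauer_config \<Rightarrow> 'a set \<Rightarrow> 'a set" where
  "nontruncated_in \<Gamma> A = {\<alpha> \<in> A. \<not> truncated \<Gamma> \<alpha>}"

definition special_cycle :: "('a, 'p) brauer_config \<Rightarrow> 'a \<Rightarrow> nat \<Rightarrow> ('a \<times> nat) list" where
  "special_cycle \<Gamma> \<alpha> l = rotate l (map (\<lambda>j. (\<alpha>, j)) [0..<val \<Gamma> \<alpha>])"

definition special_cycles :: "('a, 'p) brauer_config \<Rightarrow> 'a \<Rightarrow> ('a \<times> nat) list set" where
  "special_cycles \<Gamma> \<alpha> = {special_cycle \<Gamma> \<alpha> l | l. l < val \<Gamma> \<alpha>}"

definition special_cycles_at :: "('a, 'p) brauer_config \<Rightarrow> 'a \<Rightarrow> 'p \<Rightarrow> ('a \<times> nat) list set" where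
  "special_cycles_at \<Gamma> \<alpha> V = {C \<in> special_cycles \<Gamma> \<alpha>. tail (bc_quiver \<Gamma>) (hd C) = V}"

definition cycle_power :: "nat \<Rightarrow> 'e list \<Rightarrow> 'e list" where
  "cycle_power m C = concat (replicate m C)"

definition relations_one ::
    "'k itself \<Rightarrow> ('a, 'p) brauer_config \<Rightarrow> ('p \<times> ('a \<times> nat) list \<Rightarrow> 'k :: field) set" where
  "relations_one K \<Gamma> =
     {path_elem K (V, cycle_power (bc_mult \<Gamma> \<alpha>) C)
        \<ominus>\<^bsub>path_algebra K (bc_quiver \<Gamma>)\<^esub> path_elem K (V, cycle_power (bc_mult \<Gamma> \<beta>) D)
      | V \<alpha> \<beta> C D. V \<in> bc_polygons \<Gamma>
          \<and> \<alpha> \<in> nontruncated_in \<Gamma> (polygon_vertices \<Gamma> V)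
          \<and> \<beta> \<in> nontruncated_in \<Gamma> (polygon_vertices \<Gamma> V)
          \<and> C \<in> special_cycles_at \<Gamma> \<alpha> V \<and> D \<in> special_cycles_at \<Gamma> \<beta> V}"

definition relations_two ::
    "'k itself \<Rightarrow> ('a, 'p) brauer_config \<Rightarrow> ('p \<times> ('a \<times> nat) list \<Rightarrow> 'k :: field) set" where
  "relations_two K \<Gamma> =
     {path_elem K (tail (bc_quiver \<Gamma>) (hd C), cycle_power (bc_mult \<Gamma> \<alpha>) C @ [hd C])
      | \<alpha> C. \<alpha> \<in> nontruncated_in \<Gamma> (bc_vertices \<Gamma>) \<and> C \<in> special_cycles \<Gamma> \<alpha>}"

definition relations_three ::
    "'k itself \<Rightarrow> ('a, 'p) brauer_config \<Rightarrow> ('p \<times> ('a \<times> nat) list \<Rightarrow> 'k :: field) set" where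
  "relations_three K \<Gamma> =
     {path_elem K (v, [a, b])
      | v a b. (v, [a, b]) \<in> paths (bc_quiver \<Gamma>)
          \<and> \<not> (\<exists>\<alpha>\<in>nontruncated_in \<Gamma> (bc_vertices \<Gamma>). \<exists>C\<in>special_cycles \<Gamma> \<alpha>. sublist [a, b] C)
          \<and> \<not> (\<exists>\<alpha>. val \<Gamma> \<alpha> = 1 \<and> bc_mult \<Gamma> \<alpha> > 1 \<and> a = (\<alpha>, 0) \<and> b = (\<alpha>, 0))}"

definition brauer_ideal ::
    "'k itself \<Rightarrow> ('a, 'p) brauer_config \<Rightarrow> ('p \<times> ('a \<times> nat) list \<Rightarrow> 'k :: field) set" where
  "brauer_ideal K \<Gamma> = Idl\<^bsub>path_algebra K (bc_quiver \<Gamma>)\<^esub>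
     (relations_one K \<Gamma> \<union> relations_two K \<Gamma> \<union> relations_three K \<Gamma>)"

definition brauer_algebra ::
    "'k itself \<Rightarrow> ('a, 'p) brauer_config \<Rightarrow> ('p \<times> ('a \<times> nat) list \<Rightarrow> 'k :: field) set ring" where
  "brauer_algebra K \<Gamma> = path_algebra K (bc_quiver \<Gamma>) Quot brauer_ideal K \<Gamma>"

definition brauer_class ::
    "'k itself \<Rightarrow> ('a, 'p) brauer_config \<Rightarrow> ('p \<times> ('a \<times> nat) list \<Rightarrow> 'k :: field)
      \<Rightarrow> ('p \<times> ('a \<times> nat) list \<Rightarrow> 'k) set" where
  "brauer_class K \<Gamma> f = brauer_ideal K \<Gamma> +>\<^bsub>path_algebra K (bc_quiver \<Gamma>)\<^esub> f"

definition brauer_scalars ::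
    "'k itself \<Rightarrow> ('a, 'p) brauer_config \<Rightarrow> ('p \<times> ('a \<times> nat) list \<Rightarrow> 'k :: field) set set" where
  "brauer_scalars K \<Gamma> = brauer_class K \<Gamma> ` path_scalars K (bc_quiver \<Gamma>)"

definition brauer_cartan_matrix ::
    "'k :: field itself \<Rightarrow> ('a, 'p) brauer_config \<Rightarrow> 'p \<Rightarrow> 'p \<Rightarrow> nat" where
  "brauer_cartan_matrix K \<Gamma> = cartan_matrix (brauer_algebra K \<Gamma>) (brauer_scalars K \<Gamma>)
     (\<lambda>V. brauer_class K \<Gamma> (path_elem K (V, [])))"

end

(*
  A path is nonzero in the quotient only if it is trivial or runs along consecutive arrows of a single
  nontruncated vertex alpha for at most mu(alpha) * val(alpha) steps, and all runs of exactly that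
  length which start at v represent one and the same socle element. Sending a path to itself, to a
  chosen representative of the socle element, or to zero, is a congruence on the path category. The
  linear functionals that respect it cut out an ideal which contains all relations, so distinct
  normal forms are linearly independent modulo the relations; conversely the relations rewrite every
  path to its normal form. So the normal paths from w to v form a basis of w Lambda v. A run is
  determined by its first arrow and its length, and among the mu(alpha) * val(alpha) lengths
  0, 1, ..., mu(alpha) * val(alpha) - 1 exactly mu(alpha) * occ(alpha, V) make it end at v.
*)
theory Submission
  imports Defs "HOL-Computational_Algebra.Formal_Power_Series"
begin

section \<open>The path algebra as a ring\<close>

text \<open>The rewriting shows only that the normal paths span. The obstacle is that nothing more
  may collapse, although the ideal is known by generators alone. Functionals settle this because
  multiplication by an element can be transposed to them, so that a statement on all elements of the
  ideal reduces to one on concatenations of paths. The congruence holds because zero paths stay zero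
  when extended and because a nonempty path attached to either end of a run of length
  \<mu>(\<alpha>) val(\<alpha>) gives zero, whichever vertex the run belongs to; identifying these
  runs at v therefore creates no further identifications. The 2 on the diagonal stands for the
  trivial path and the socle element. Both are shared by all vertices of the polygon and are counted
  once, and the -1 in each summand removes the length 0 for each starting arrow. Truncated vertices
  carry no arrows, but the formula sums over them too: such a vertex has occ(\<alpha>,V) =
  \<mu>(\<alpha>) = 1 in its only polygon and lies in no second one, so it contributes 0.\<close>

abbreviation supp :: "('x \<Rightarrow> 'k::zero) \<Rightarrow> 'x set" where
  "supp f \<equiv> {x. f x \<noteq> 0}"

lemma path_algebra_simps:
  "carrier (path_algebra K Q) = {f. finite (supp f) \<and> supp f \<subseteq> paths Q}"
  "(f \<otimes>\<^bsub>path_algebra K Q\<^esub> g) (u, p) = (\<Sum>i\<le>length p.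
       f (u, take i p) * g (pre_digraph.awlast Q u (take i p), drop i p))"
  "\<one>\<^bsub>path_algebra K Q\<^esub> (u, p) = (if u \<in> verts Q \<and> p = [] then 1 else 0)"
  "\<zero>\<^bsub>path_algebra K Q\<^esub> = (\<lambda>_. 0)"
  "f \<oplus>\<^bsub>path_algebra K Q\<^esub> g = (\<lambda>x. f x + g x)"
  by (simp_all add: path_algebra_def)

lemma (in pre_digraph) awlast_append: "awlast u (p @ q) = awlast (awlast u p) q"
  by (simp add: awalk_verts_conv)

lemma (in wf_digraph) paths_iff: "(u, p) \<in> paths G \<longleftrightarrow> awalk u p (awlast u p)"
  by (auto simp: paths_def awalk_def awlast_if_cas)

lemma (in wf_digraph) paths_append_iff:
  "(u, p @ q) \<in> paths G \<longleftrightarrow> (u, p) \<in> paths G \<and> (awlast u p, q) \<in> paths G"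
  unfolding paths_iff by (simp add: awalk_append_iff awlast_append)

lemma (in wf_digraph) paths_start: "(u, p) \<in> paths G \<Longrightarrow> u \<in> verts G"
  by (simp add: paths_iff awalk_def)

lemma (in wf_digraph) paths_end: "(u, p) \<in> paths G \<Longrightarrow> awlast u p \<in> verts G"
  using awalk_last_in_verts by (simp add: paths_iff)

lemma (in wf_digraph) trivial_path [simp]: "(u, []) \<in> paths G \<longleftrightarrow> u \<in> verts G"
  by (simp add: paths_iff awalk_Nil_iff)

context fin_digraph
begin

lemma supp_mult:
  "supp (f \<otimes>\<^bsub>path_algebra K G\<^esub> g) \<subseteq>
    (\<lambda>((u, p), (v, q)). (u, p @ q)) ` {((u, p), (v, q)).
      (u, p) \<in> supp f \<and> (v, q) \<in> supp g \<and> awlast u p = v}"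
proof
  fix x assume x: "x \<in> supp (f \<otimes>\<^bsub>path_algebra K G\<^esub> g)"
  obtain u r where ur: "x = (u, r)" by fastforce
  with x have "(\<Sum>i\<le>length r. f (u, take i r) * g (awlast u (take i r), drop i r)) \<noteq> 0"
    by (simp add: path_algebra_simps)
  then obtain i where "f (u, take i r) * g (awlast u (take i r), drop i r) \<noteq> 0"
    by (meson sum.neutral)
  then show "x \<in> (\<lambda>((u, p), (v, q)). (u, p @ q)) ` {((u, p), (v, q)).
      (u, p) \<in> supp f \<and> (v, q) \<in> supp g \<and> awlast u p = v}"
    unfolding ur
    by (intro image_eqI[where x = "((u, take i r), (awlast u (take i r), drop i r))"]) auto
qed

lemma mult_closed:
  assumes "f \<in> carrier (path_algebra K G)" "g \<in> carrier (path_algebra K G)"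
  shows "f \<otimes>\<^bsub>path_algebra K G\<^esub> g \<in> carrier (path_algebra K G)"
proof -
  let ?S = "{((u, p), (v, q)). (u, p) \<in> supp f \<and> (v, q) \<in> supp g \<and> awlast u p = v}"
  have "?S \<subseteq> supp f \<times> supp g" by auto
  then have "finite ?S"
    using assms by (rule_tac finite_subset) (auto simp: path_algebra_simps)
  moreover have "(\<lambda>((u, p), (v, q)). (u, p @ q)) ` ?S \<subseteq> paths G"
    using assms by (auto simp: path_algebra_simps paths_append_iff subset_iff)
  ultimately show ?thesis
    unfolding path_algebra_simps(1)
    by (intro CollectI conjI finite_subset[OF supp_mult finite_imageI] subset_trans[OF supp_mult])
qed

lemma mult_assoc:
  "(f \<otimes>\<^bsub>path_algebra K G\<^esub> g) \<otimes>\<^bsub>path_algebra K G\<^esub> h =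
   f \<otimes>\<^bsub>path_algebra K G\<^esub> (g \<otimes>\<^bsub>path_algebra K G\<^esub> h)" (is "?L = ?R")
proof
  fix x :: "'a \<times> 'b list"
  obtain u p where x: "x = (u, p)" by fastforce
  define n where "n = length p"
  \<comment> \<open>The contribution of cutting \<open>p\<close> into consecutive pieces of lengths
    \<open>a\<close>, \<open>b\<close> and \<open>c\<close>, where a + b + c = n. Both bracketings
    sum it over all such triples, and the exchange is the reindexing behind associativity of power
    series products.\<close>
  define F where "F a b c = f (u, take a p) * g (awlast u (take a p), take b (drop a p))
    * h (awlast u (take (a + b) p), drop (a + b) p)" for a b c :: nat
  have "?L x = (\<Sum>j\<le>n. \<Sum>i\<le>j. F i (j - i) (n - j))"
    unfolding x n_def F_def path_algebra_simps
    by (auto simp: sum_distrib_right min_def drop_take intro!: sum.cong)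
  also have "\<dots> = (\<Sum>j\<le>n. \<Sum>i\<le>n - j. F j i (n - j - i))"
    using fps_mult_assoc_lemma[of F n n] by (simp add: atLeast0AtMost)
  also have "\<dots> = ?R x"
    unfolding x n_def F_def path_algebra_simps
    by (auto simp: sum_distrib_left mult.assoc take_add awlast_append add.commute
        intro!: sum.cong)
  finally show "?L x = ?R x" .
qed

text \<open>Only the cut before the first arrow contributes, because the unit is supported on
  trivial paths. The case c = 1 is the left unit law; general c identifies multiplication by
  \<open>path_scalars\<close> with scaling of coefficients.\<close>

lemma scalar_mult:
  assumes "f \<in> carrier (path_algebra K G)"
  shows "(\<lambda>x. c * \<one>\<^bsub>path_algebra K G\<^esub> x) \<otimes>\<^bsub>path_algebra K G\<^esub> f = (\<lambda>x. c * f x)"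
proof
  fix x :: "'a \<times> 'b list"
  obtain u p where x: "x = (u, p)" by fastforce
  have "u \<in> verts G" if "f (u, p) \<noteq> 0"
    using that assms paths_start by (auto simp: path_algebra_simps)
  moreover have "((\<lambda>x. c * \<one>\<^bsub>path_algebra K G\<^esub> x) \<otimes>\<^bsub>path_algebra K G\<^esub> f) (u, p) =
      (\<Sum>i\<le>length p. if i = 0 then c * (if u \<in> verts G then 1 else 0) * f (u, p) else 0)"
    unfolding path_algebra_simps by (intro sum.cong) auto
  ultimately show "((\<lambda>x. c * \<one>\<^bsub>path_algebra K G\<^esub> x) \<otimes>\<^bsub>path_algebra K G\<^esub> f) x = c * f x"
    unfolding x by (auto simp: sum.delta)
qed

lemma right_one:
  assumes "f \<in> carrier (path_algebra K G)"
  shows "f \<otimes>\<^bsub>path_algebra K G\<^esub> \<one>\<^bsub>path_algebra K G\<^esub> = f"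
proof
  fix x :: "'a \<times> 'b list"
  obtain u p where x: "x = (u, p)" by fastforce
  have "awlast u p \<in> verts G" if "f (u, p) \<noteq> 0"
    using that assms paths_end by (auto simp: path_algebra_simps)
  moreover have "(f \<otimes>\<^bsub>path_algebra K G\<^esub> \<one>\<^bsub>path_algebra K G\<^esub>) (u, p) =
      (\<Sum>i\<le>length p. if i = length p then f (u, p) * (if awlast u p \<in> verts G then 1 else 0) else 0)"
    unfolding path_algebra_simps by (intro sum.cong) auto
  ultimately show "(f \<otimes>\<^bsub>path_algebra K G\<^esub> \<one>\<^bsub>path_algebra K G\<^esub>) x = f x"
    unfolding x by (auto simp: sum.delta)
qed

lemma one_in_carrier: "\<one>\<^bsub>path_algebra K G\<^esub> \<in> carrier (path_algebra K G)"
proof -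
  have "supp (\<one>\<^bsub>path_algebra K G\<^esub>) \<subseteq> (\<lambda>u. (u, [])) ` verts G"
    by (auto simp: path_algebra_simps split: if_splits)
  moreover have "(\<lambda>u. (u, [])) ` verts G \<subseteq> paths G" by auto
  ultimately show ?thesis
    unfolding path_algebra_simps(1)
    using finite_subset[OF _ finite_imageI[OF finite_verts]] by auto
qed

lemma lincomb_closed:
  assumes "f \<in> carrier (path_algebra K G)" "g \<in> carrier (path_algebra K G)"
  shows "(\<lambda>x. c * f x + d * g x) \<in> carrier (path_algebra K G)"
proof -
  have "supp (\<lambda>x. c * f x + d * g x) \<subseteq> supp f \<union> supp g" by auto
  then show ?thesis
    using assms unfolding path_algebra_simps(1) by (auto intro: finite_subset)
qed

lemma path_algebra_ring: "ring (path_algebra K G)"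
proof (rule ringI)
  show "abelian_group (path_algebra K G)"
  proof (rule abelian_groupI)
    fix f assume f: "f \<in> carrier (path_algebra K G)"
    show "\<exists>g\<in>carrier (path_algebra K G). g \<oplus>\<^bsub>path_algebra K G\<^esub> f = \<zero>\<^bsub>path_algebra K G\<^esub>"
      using lincomb_closed[OF f f, of "- 1" 0]
      by (intro bexI[where x = "\<lambda>x. - f x"]) (simp_all add: path_algebra_simps(4,5))
  next
    fix f g assume "f \<in> carrier (path_algebra K G)" "g \<in> carrier (path_algebra K G)"
    then show "f \<oplus>\<^bsub>path_algebra K G\<^esub> g \<in> carrier (path_algebra K G)"
      using lincomb_closed[of f K g 1 1] by (simp add: path_algebra_simps(5))
  qed (simp_all add: path_algebra_simps(1,4,5) fun_eq_iff algebra_simps)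
  show "monoid (path_algebra K G)"
    using scalar_mult[of _ K 1]
    by (intro monoidI) (simp_all add: mult_closed mult_assoc right_one one_in_carrier)
qed (auto simp: path_algebra_simps fun_eq_iff sum.distrib algebra_simps)

lemma path_algebra_minus:
  assumes "f \<in> carrier (path_algebra K G)" "g \<in> carrier (path_algebra K G)"
  shows "f \<ominus>\<^bsub>path_algebra K G\<^esub> g = (\<lambda>x. f x - g x)"
proof -
  interpret R: ring "path_algebra K G" by (rule path_algebra_ring)
  have "(\<lambda>x. - g x) \<in> carrier (path_algebra K G)"
    using lincomb_closed[OF assms(2,2), of "- 1" 0] by simp
  then have "\<ominus>\<^bsub>path_algebra K G\<^esub> g = (\<lambda>x. - g x)"
    using assms by (intro R.minus_equality) (simp_all add: path_algebra_simps(4,5))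
  then show ?thesis by (simp add: a_minus_def path_algebra_simps(5))
qed

end

section \<open>Linear functionals on the path algebra\<close>

definition pairing :: "('x \<Rightarrow> 'k) \<Rightarrow> ('x \<Rightarrow> 'k) \<Rightarrow> 'k::field" where
  "pairing f \<psi> = (\<Sum>x\<in>supp f. f x * \<psi> x)"

lemma pairing_superset:
  assumes "finite A" "supp f \<subseteq> A"
  shows "pairing f \<psi> = (\<Sum>x\<in>A. f x * \<psi> x)"
  unfolding pairing_def using assms by (intro sum.mono_neutral_left) auto

lemma pairing_lincomb:
  assumes "finite (supp f)" "finite (supp g)"
  shows "pairing (\<lambda>x. c * f x + d * g x) \<psi> = c * pairing f \<psi> + d * pairing g \<psi>"
proof -
  let ?A = "supp f \<union> supp g"
  have "pairing (\<lambda>x. c * f x + d * g x) \<psi> = (\<Sum>x\<in>?A. (c * f x + d * g x) * \<psi> x)"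
    using assms by (intro pairing_superset) auto
  moreover have "pairing f \<psi> = (\<Sum>x\<in>?A. f x * \<psi> x)" "pairing g \<psi> = (\<Sum>x\<in>?A. g x * \<psi> x)"
    using assms by (intro pairing_superset; auto)+
  ultimately show ?thesis
    by (simp add: algebra_simps sum.distrib sum_distrib_left)
qed

lemma pairing_path_elem [simp]: "pairing (path_elem K x) \<psi> = \<psi> x"
  by (subst pairing_superset[of "{x}"]) (auto simp: path_elem_def)

context fin_digraph
begin

text \<open>A coefficient of the product sums over the cuts of one path, the right-hand side over
  pairs of factors; a path with a chosen cut is the same as a composable pair. In this form
  multiplication by a fixed factor can be moved onto \<psi>.\<close>

lemma pairing_mult:
  assumes "f \<in> carrier (path_algebra K G)" "g \<in> carrier (path_algebra K G)"
  shows "pairing (f \<otimes>\<^bsub>path_algebra K G\<^esub> g) \<psi> =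
    (\<Sum>x\<in>supp f. \<Sum>z\<in>supp g.
      if awlast (fst x) (snd x) = fst z then f x * g z * \<psi> (fst x, snd x @ snd z) else 0)"
proof -
  define A where "A = (\<lambda>((u, p), (v, q)). (u, p @ q)) ` (supp f \<times> supp g)"
  define t where "t = (\<lambda>((u, r), i).
    f (u, take i r) * g (awlast u (take i r), drop i r) * \<psi> (u, r))"
  define s where "s = (\<lambda>((u, p), (v, q)).
    if awlast u p = v then f (u, p) * g (v, q) * \<psi> (u, p @ q) else 0)"
  define S where "S = Sigma A (\<lambda>x. {..length (snd x)})"
  define i where "i = (\<lambda>((u :: 'a, p :: 'b list), (v :: 'a, q)). ((u, p @ q), length p))"
  define j where "j = (\<lambda>((u, r), i). ((u, take i r), (awlast u (take i r), drop i r)))"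
  have fin: "finite (supp f \<times> supp g)" "finite A"
    using assms unfolding A_def by (auto simp: path_algebra_simps)
  have "supp (f \<otimes>\<^bsub>path_algebra K G\<^esub> g) \<subseteq> A"
    unfolding A_def by (intro subset_trans[OF supp_mult] image_mono) auto
  then have "pairing (f \<otimes>\<^bsub>path_algebra K G\<^esub> g) \<psi> =
      (\<Sum>x\<in>A. (f \<otimes>\<^bsub>path_algebra K G\<^esub> g) x * \<psi> x)"
    using fin by (intro pairing_superset)
  also have "\<dots> = (\<Sum>x\<in>A. \<Sum>i\<le>length (snd x). t (x, i))"
    by (intro sum.cong refl)
      (auto simp: path_algebra_simps t_def sum_distrib_right split: prod.splits)
  also have "\<dots> = sum t S"
    unfolding S_def using fin by (subst sum.Sigma) auto
  also have "\<dots> = sum s (supp f \<times> supp g)"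
  \<comment> \<open>Cuts with a piece outside the supports and pairs that do not compose are not
    matched by \<open>i\<close> and \<open>j\<close>. Their terms vanish, so the correspondence is
    required only between nonzero terms.\<close>
  proof (rule sum.reindex_bij_witness_not_neutral
      [where S' = "{a \<in> S. t a = 0}" and T' = "{b \<in> supp f \<times> supp g. s b = 0}"
        and i = i and j = j])
    show "finite {a \<in> S. t a = 0}" unfolding S_def using fin by auto
    show "finite {b \<in> supp f \<times> supp g. s b = 0}" using fin by auto
  next
    fix b assume "b \<in> supp f \<times> supp g - {b \<in> supp f \<times> supp g. s b = 0}"
    then obtain u p v q where b: "b = ((u, p), (v, q))" "f (u, p) \<noteq> 0" "g (v, q) \<noteq> 0"
      "s ((u, p), (v, q)) \<noteq> 0"
      by (cases b) auto
    then have v: "awlast u p = v" "\<psi> (u, p @ q) \<noteq> 0" by (auto simp: s_def split: if_splits)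
    moreover have "(u, p @ q) \<in> A"
      unfolding A_def using b by (force simp: image_iff)
    ultimately show "i b \<in> S - {a \<in> S. t a = 0}"
      unfolding S_def t_def i_def using b by auto
    show "j (i b) = b"
      unfolding i_def j_def using b v by simp
  qed (auto simp: S_def t_def s_def i_def j_def split: if_splits)
  finally show ?thesis
    unfolding s_def sum.cartesian_product by (simp only: case_prod_unfold prod.collapse)
qed

lemma path_elem_carrier:
  "path_elem K x \<in> carrier (path_algebra K G) \<longleftrightarrow> x \<in> paths G"
  by (auto simp: path_algebra_simps path_elem_def)

lemma path_elem_mult:
  assumes "awlast u p = v"
  shows "path_elem K (u, p) \<otimes>\<^bsub>path_algebra K G\<^esub> path_elem K (v, q) = path_elem K (u, p @ q)"
proof
  fix x :: "'a \<times> 'b list"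
  obtain w r where x: "x = (w, r)" by fastforce
  have "(path_elem K (u, p) \<otimes>\<^bsub>path_algebra K G\<^esub> path_elem K (v, q)) (w, r) =
      (\<Sum>i\<le>length r. if i = length p then if w = u \<and> r = p @ q then 1 else 0 else 0)"
    unfolding path_algebra_simps
  proof (intro sum.cong refl)
    fix i assume i: "i \<in> {..length r}"
    have "take i r = p \<and> drop i r = q \<longleftrightarrow> i = length p \<and> r = p @ q"
      using i by auto
    moreover have "path_elem K (u, p) (w, take i r) * path_elem K (v, q) (awlast w (take i r), drop i r) =
        (if w = u \<and> take i r = p \<and> drop i r = q then 1 else 0)"
      using assms by (auto simp: path_elem_def simp del: take_append drop_append)
    ultimately show "path_elem K (u, p) (w, take i r) * path_elem K (v, q) (awlast w (take i r), drop i r) =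
        (if i = length p then if w = u \<and> r = p @ q then 1 else 0 else 0)"
      by simp
  qed
  then show "(path_elem K (u, p) \<otimes>\<^bsub>path_algebra K G\<^esub> path_elem K (v, q)) x = path_elem K (u, p @ q) x"
    unfolding x by (auto simp: path_elem_def)
qed

lemma idempotent_cut:
  "(path_elem K (w, []) \<otimes>\<^bsub>path_algebra K G\<^esub> f \<otimes>\<^bsub>path_algebra K G\<^esub> path_elem K (v, [])) (u, p) =
    (if u = w \<and> awlast u p = v then f (u, p) else 0)"
proof -
  have l: "(path_elem K (w, []) \<otimes>\<^bsub>path_algebra K G\<^esub> f) (u, p) = (if u = w then f (u, p) else 0)"
    for u p
  proof -
    have "(path_elem K (w, []) \<otimes>\<^bsub>path_algebra K G\<^esub> f) (u, p) =
      (\<Sum>i\<le>length p. if i = 0 then (if u = w then f (u, p) else 0) else 0)"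
      unfolding path_algebra_simps path_elem_def by (intro sum.cong refl) auto
    then show ?thesis by simp
  qed
  have "(g \<otimes>\<^bsub>path_algebra K G\<^esub> path_elem K (v, [])) (u, p) =
      (if awlast u p = v then g (u, p) else 0)" for g
  proof -
    have "(g \<otimes>\<^bsub>path_algebra K G\<^esub> path_elem K (v, [])) (u, p) =
      (\<Sum>i\<le>length p. if i = length p then (if awlast u p = v then g (u, p) else 0) else 0)"
      unfolding path_algebra_simps path_elem_def by (intro sum.cong refl) auto
    then show ?thesis by simp
  qed
  then show ?thesis by (simp add: l)
qed

section \<open>The ground field and the dimension of spans of paths\<close>

lemma path_scalars_subfield:
  assumes "verts G \<noteq> {}"
  shows "subfield (path_scalars K G) (path_algebra K G)"
proof -
  interpret R: ring "path_algebra K G" by (rule path_algebra_ring)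
  define sc where "sc c = (\<lambda>x. c * \<one>\<^bsub>path_algebra K G\<^esub> x)" for c
  have S: "path_scalars K G = range sc"
    by (simp add: path_scalars_def sc_def[abs_def])
  have carr: "sc c \<in> carrier (path_algebra K G)" for c
    using lincomb_closed[OF one_in_carrier one_in_carrier, of c K 0] by (simp add: sc_def)
  have mult: "sc c \<otimes>\<^bsub>path_algebra K G\<^esub> sc d = sc (c * d)" for c d
    using scalar_mult[OF carr, of c d] by (simp add: sc_def mult.assoc)
  have zero: "sc 0 = \<zero>\<^bsub>path_algebra K G\<^esub>" and one: "sc 1 = \<one>\<^bsub>path_algebra K G\<^esub>"
    by (simp_all add: sc_def path_algebra_simps(4))
  have add: "sc c \<oplus>\<^bsub>path_algebra K G\<^esub> sc d = sc (c + d)" for c d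
    by (simp add: sc_def path_algebra_simps(5) algebra_simps)
  have uminus: "\<ominus>\<^bsub>path_algebra K G\<^esub> sc c = sc (- c)" for c
    using add[of "- c" c] carr by (intro R.minus_equality) (simp_all add: zero)
  obtain v where v: "v \<in> verts G" using assms by auto
  \<comment> \<open>The scalar can be read off at a trivial path, and the assumed vertex supplies
    one. The case c = 1 keeps the unit apart from zero.\<close>
  have ne: "sc c \<noteq> \<zero>\<^bsub>path_algebra K G\<^esub>" if "c \<noteq> 0" for c
  proof
    assume "sc c = \<zero>\<^bsub>path_algebra K G\<^esub>"
    then have "sc c (v, []) = 0" by (simp add: path_algebra_simps(4))
    then show False using v that by (simp add: sc_def path_algebra_simps(3))
  qed
  have "subring (range sc) (path_algebra K G)"
    using carr one by (intro R.subringI) (auto simp: uminus mult add intro: range_eqI[where x = 1])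
  then have "subcring (range sc) (path_algebra K G)"
    by (intro R.subcringI) (auto simp: mult mult.commute)
  moreover have "Units (path_algebra K G\<lparr>carrier := range sc\<rparr>) =
      range sc - {\<zero>\<^bsub>path_algebra K G\<^esub>}"
  proof (intro equalityI subsetI)
    fix x assume "x \<in> Units (path_algebra K G\<lparr>carrier := range sc\<rparr>)"
    then obtain c d where "x = sc c" "sc c \<otimes>\<^bsub>path_algebra K G\<^esub> sc d = \<one>\<^bsub>path_algebra K G\<^esub>"
      by (auto simp: Units_def)
    then show "x \<in> range sc - {\<zero>\<^bsub>path_algebra K G\<^esub>}"
      using carr ne[of 1] one by auto
  next
    fix x assume "x \<in> range sc - {\<zero>\<^bsub>path_algebra K G\<^esub>}"
    then obtain c where x: "x = sc c" "c \<noteq> 0" using zero by auto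
    then show "x \<in> Units (path_algebra K G\<lparr>carrier := range sc\<rparr>)"
      unfolding Units_def using mult[of c "inverse c"] mult[of "inverse c" c] one by auto
  qed
  ultimately show ?thesis
    unfolding S by (rule R.subfieldI)
qed

definition supported :: "'k itself \<Rightarrow> ('a \<times> 'b list) set \<Rightarrow> ('a \<times> 'b list \<Rightarrow> 'k::field) set" where
  "supported K X = {f \<in> carrier (path_algebra K G). supp f \<subseteq> X}"

lemma supported_empty: "supported K {} = {\<zero>\<^bsub>path_algebra K G\<^esub>}"
  by (auto simp: supported_def path_algebra_simps(1,4) fun_eq_iff)

text \<open>The dimension predicate is built by adjoining one line at a time, so the span of a set
  of paths is described in the same inductive way. Subtracting the term at \<open>x\<close> leaves
  an element supported on \<open>X\<close>.\<close>

lemma supported_insert: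
  assumes "x \<in> paths G"
  shows "supported K (insert x X) =
    ring.line_extension (path_algebra K G) (path_scalars K G) (path_elem K x) (supported K X)"
proof -
  interpret R: ring "path_algebra K G" by (rule path_algebra_ring)
  have e: "path_elem K x \<in> carrier (path_algebra K G)"
    using assms by (simp add: path_elem_carrier)
  have m: "(\<lambda>y. c * \<one>\<^bsub>path_algebra K G\<^esub> y) \<otimes>\<^bsub>path_algebra K G\<^esub> path_elem K x \<oplus>\<^bsub>path_algebra K G\<^esub> g =
      (\<lambda>y. c * path_elem K x y + g y)" for c g
    by (simp add: scalar_mult[OF e] path_algebra_simps(5))
  show ?thesis
  proof (intro equalityI subsetI)
    fix f assume f: "f \<in> supported K (insert x X)"
    define g where "g = (\<lambda>y. 1 * f y + (- f x) * path_elem K x y)"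
    have "g \<in> carrier (path_algebra K G)"
      unfolding g_def by (rule lincomb_closed) (use f e in \<open>auto simp: supported_def\<close>)
    moreover have "supp g \<subseteq> X"
      using f by (auto simp: g_def path_elem_def supported_def split: if_splits)
    ultimately have "g \<in> supported K X" by (simp add: supported_def)
    moreover have "f = (\<lambda>y. f x * path_elem K x y + g y)"
      by (simp add: g_def)
    ultimately show "f \<in> R.line_extension (path_scalars K G) (path_elem K x) (supported K X)"
      unfolding R.line_extension_mem_iff path_scalars_def
      by (intro rev_bexI[OF rangeI[where x = "f x"]] bexI[where x = g]) (simp_all only: m)
  next
    fix f assume "f \<in> R.line_extension (path_scalars K G) (path_elem K x) (supported K X)"
    then obtain c g where g: "g \<in> supported K X" and f: "f = (\<lambda>y. c * path_elem K x y + g y)"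
      unfolding R.line_extension_mem_iff path_scalars_def using m by auto
    have "(\<lambda>y. c * path_elem K x y + 1 * g y) \<in> carrier (path_algebra K G)"
      by (rule lincomb_closed) (use g e in \<open>auto simp: supported_def\<close>)
    then show "f \<in> supported K (insert x X)"
      using g by (auto simp: f supported_def path_elem_def split: if_splits)
  qed
qed

lemma dimension_supported:
  assumes "finite X" "X \<subseteq> paths G"
  shows "ring.dimension (path_algebra K G) (card X) (path_scalars K G) (supported K X)"
  using assms
proof (induction X rule: finite_induct)
  case empty
  interpret R: ring "path_algebra K G" by (rule path_algebra_ring)
  show ?case by (simp add: supported_empty)
next
  case (insert x X)
  interpret R: ring "path_algebra K G" by (rule path_algebra_ring)
  have "path_elem K x \<in> carrier (path_algebra K G)" "path_elem K x \<notin> supported K X"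
    using insert unfolding path_elem_carrier by (auto simp: supported_def path_elem_def)
  then show ?case
    using insert R.Suc_dim[of "path_elem K x" "supported K X"] by (simp add: supported_insert)
qed

end

section \<open>Quotients with a normal form on paths\<close>

lemma FactRing_zero: "\<zero>\<^bsub>R Quot I\<^esub> = I"
  by (simp add: FactRing_def)

lemma FactRing_carrier: "carrier (R Quot I) = (\<lambda>x. I +>\<^bsub>R\<^esub> x) ` carrier R"
  by (auto simp: FactRing_def A_RCOSETS_def' a_r_coset_def')

text \<open>
  \<^const>\<open>None\<close> is the normal form of a path which is zero in the quotient.
\<close>

locale path_rewriting = fin_digraph G for G :: "('a, 'b) pre_digraph" +
  fixes nf :: "'a \<times> 'b list \<Rightarrow> ('a \<times> 'b list) option"
  assumes nf_path: "\<lbrakk>(u, p) \<in> paths G; nf (u, p) = Some (v, q)\<rbrakk> \<Longrightarrow>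
      (v, q) \<in> paths G \<and> v = u \<and> awlast v q = awlast u p"
    and nf_idem: "\<lbrakk>x \<in> paths G; nf x = Some y\<rbrakk> \<Longrightarrow> nf y = Some y"
    and nf_zero_left: "\<lbrakk>(u, p @ q) \<in> paths G; nf (awlast u p, q) = None\<rbrakk> \<Longrightarrow> nf (u, p @ q) = None"
    and nf_zero_right: "\<lbrakk>(u, p @ q) \<in> paths G; nf (u, p) = None\<rbrakk> \<Longrightarrow> nf (u, p @ q) = None"
    and nf_cong_left: "\<lbrakk>(u, p @ q) \<in> paths G; (u, p @ q') \<in> paths G;
      nf (awlast u p, q) = nf (awlast u p, q')\<rbrakk> \<Longrightarrow> nf (u, p @ q) = nf (u, p @ q')"
    and nf_cong_right: "\<lbrakk>(u, p @ q) \<in> paths G; (u, p' @ q) \<in> paths G;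
      nf (u, p) = nf (u, p')\<rbrakk> \<Longrightarrow> nf (u, p @ q) = nf (u, p' @ q)"
begin

section \<open>Functionals that respect the normal form\<close>

definition compatible :: "('a \<times> 'b list \<Rightarrow> 'k::field) \<Rightarrow> bool" where
  "compatible \<psi> \<longleftrightarrow> (\<forall>x\<in>paths G. nf x = None \<longrightarrow> \<psi> x = 0) \<and>
    (\<forall>x\<in>paths G. \<forall>y\<in>paths G. nf x = nf y \<longrightarrow> \<psi> x = \<psi> y)"

text \<open>The common annihilator of the compatible functionals. Once it is an ideal, it contains
  every ideal whose generators it contains, so these functionals descend to the quotient and can
  separate classes there.\<close>

definition nf_kernel :: "'k itself \<Rightarrow> ('a \<times> 'b list \<Rightarrow> 'k::field) set" where
  "nf_kernel K = {f \<in> carrier (path_algebra K G). \<forall>\<psi>. compatible \<psi> \<longrightarrow> pairing f \<psi> = 0}"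

lemma compatible_cong:
  assumes "compatible \<psi>" "x \<in> paths G" "y \<in> paths G" "nf x = nf y"
  shows "\<psi> x = \<psi> y"
proof -
  have "\<forall>x\<in>paths G. \<forall>y\<in>paths G. nf x = nf y \<longrightarrow> \<psi> x = \<psi> y"
    using assms(1) unfolding compatible_def by (rule conjunct2)
  from this[rule_format, OF assms(2-)] show ?thesis .
qed

lemma compatible_zero:
  assumes "compatible \<psi>" "x \<in> paths G" "nf x = None"
  shows "\<psi> x = 0"
proof -
  have "\<forall>x\<in>paths G. nf x = None \<longrightarrow> \<psi> x = 0"
    using assms(1) unfolding compatible_def by (rule conjunct1)
  from this[rule_format, OF assms(2-)] show ?thesis .
qed

text \<open>Normal forms keep both endpoints, so two paths with the same form other than
  \<open>None\<close> are parallel. Hence the congruence may be checked on parallel paths only, and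
  these compose with the same third paths.\<close>

lemma compatibleI:
  assumes zero: "\<And>u p. \<lbrakk>(u, p) \<in> paths G; nf (u, p) = None\<rbrakk> \<Longrightarrow> \<psi> (u, p) = 0"
    and cong: "\<And>u p q. \<lbrakk>(u, p) \<in> paths G; (u, q) \<in> paths G; awlast u p = awlast u q;
      nf (u, p) = nf (u, q)\<rbrakk> \<Longrightarrow> \<psi> (u, p) = \<psi> (u, q)"
  shows "compatible \<psi>"
  unfolding compatible_def
proof (intro conjI ballI impI)
  fix x assume "x \<in> paths G" "nf x = None"
  then show "\<psi> x = 0" using zero by (cases x) simp
next
  fix x y assume *: "x \<in> paths G" "y \<in> paths G" "nf x = nf y"
  obtain u p v q where x: "x = (u, p)" and y: "y = (v, q)" by fastforce
  show "\<psi> x = \<psi> y"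
  proof (cases "nf x")
    case None
    then show ?thesis using * zero by (simp add: x y)
  next
    case (Some z)
    obtain w r where "z = (w, r)" by fastforce
    then have "w = u \<and> awlast w r = awlast u p" "w = v \<and> awlast w r = awlast v q"
      using * Some nf_path[of u p w r] nf_path[of v q w r] by (auto simp: x y)
    then have "v = u" "awlast u p = awlast u q" by auto
    then show ?thesis using * cong[of u p q] by (simp add: x y)
  qed
qed

text \<open>The functional is \<psi> transposed along left multiplication by \<open>f\<close>. It is
  compatible term by term: for each path in the support of \<open>f\<close>, the rules
  \<open>nf_zero_left\<close> and \<open>nf_cong_left\<close> carry the hypothesis on the right
  factor over to the concatenation.\<close>

lemma compatible_left:
  assumes "compatible \<psi>" "f \<in> carrier (path_algebra K G)"
  shows "compatible (\<lambda>z. \<Sum>x\<in>supp f.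
    if awlast (fst x) (snd x) = fst z then f x * \<psi> (fst x, snd x @ snd z) else 0)"
    (is "compatible ?T")
proof -
  have sub: "(u, p) \<in> paths G" if "f (u, p) \<noteq> 0" for u p
    using that assms(2) by (auto simp: path_algebra_simps)
  show ?thesis
  proof (rule compatibleI)
    fix v q assume v: "(v, q) \<in> paths G" "nf (v, q) = None"
    have "\<psi> (u, p @ q) = 0" if "f (u, p) \<noteq> 0" "awlast u p = v" for u p
    proof -
      have "(u, p @ q) \<in> paths G"
        using v sub that by (simp add: paths_append_iff)
      moreover from this have "nf (u, p @ q) = None"
        using v that(2) by (simp add: nf_zero_left)
      ultimately show ?thesis
        by (rule compatible_zero[OF assms(1)])
    qed
    then show "?T (v, q) = 0"
      by (auto intro!: sum.neutral)
  next
    fix v q q' assume v: "(v, q) \<in> paths G" "(v, q') \<in> paths G" "nf (v, q) = nf (v, q')"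
    have "\<psi> (u, p @ q) = \<psi> (u, p @ q')" if "f (u, p) \<noteq> 0" "awlast u p = v" for u p
    proof -
      have "(u, p @ q) \<in> paths G" "(u, p @ q') \<in> paths G"
        using v sub that by (simp_all add: paths_append_iff)
      moreover from this have "nf (u, p @ q) = nf (u, p @ q')"
        by (rule nf_cong_left) (use that v in simp)
      ultimately show ?thesis
        by (rule compatible_cong[OF assms(1)])
    qed
    then show "?T (v, q) = ?T (v, q')"
      by (auto intro!: sum.cong)
  qed
qed

text \<open>Here the varying factor stands in front, so composability depends on its end; this is
  where the equality of ends supplied by \<open>compatibleI\<close> enters.\<close>

lemma compatible_right:
  assumes "compatible \<psi>" "g \<in> carrier (path_algebra K G)"
  shows "compatible (\<lambda>x. \<Sum>z\<in>supp g.
    if awlast (fst x) (snd x) = fst z then g z * \<psi> (fst x, snd x @ snd z) else 0)"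
    (is "compatible ?T")
proof -
  have sub: "(v, q) \<in> paths G" if "g (v, q) \<noteq> 0" for v q
    using that assms(2) by (auto simp: path_algebra_simps)
  show ?thesis
  proof (rule compatibleI)
    fix u p assume u: "(u, p) \<in> paths G" "nf (u, p) = None"
    have "\<psi> (u, p @ q) = 0" if "g (v, q) \<noteq> 0" "awlast u p = v" for v q
    proof -
      have "(u, p @ q) \<in> paths G"
        using u sub that by (simp add: paths_append_iff)
      moreover from this have "nf (u, p @ q) = None"
        using u by (simp add: nf_zero_right)
      ultimately show ?thesis
        by (rule compatible_zero[OF assms(1)])
    qed
    then show "?T (u, p) = 0"
      by (auto intro!: sum.neutral)
  next
    fix u p p' assume u: "(u, p) \<in> paths G" "(u, p') \<in> paths G" "awlast u p = awlast u p'"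
      "nf (u, p) = nf (u, p')"
    have "\<psi> (u, p @ q) = \<psi> (u, p' @ q)" if "g (v, q) \<noteq> 0" "awlast u p = v" for v q
    proof -
      have "(u, p @ q) \<in> paths G" "(u, p' @ q) \<in> paths G"
        using u sub that by (simp_all add: paths_append_iff)
      moreover from this have "nf (u, p @ q) = nf (u, p' @ q)"
        using u(4) by (rule nf_cong_right)
      ultimately show ?thesis
        by (rule compatible_cong[OF assms(1)])
    qed
    then show "?T (u, p) = ?T (u, p')"
      using u(3) by (auto intro!: sum.cong)
  qed
qed

text \<open>By \<open>pairing_mult\<close>, multiplication by \<open>f\<close> on either side is
  transposed to the functional. The transposed functional is compatible again, so an element of the
  kernel annihilates it too.\<close>

lemma nf_kernel_ideal: "ideal (nf_kernel K) (path_algebra K G)"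
proof (rule idealI)
  show "ring (path_algebra K G)" by (rule path_algebra_ring)
  interpret R: ring "path_algebra K G" by (rule path_algebra_ring)
  have fin: "finite (supp f)" if "f \<in> carrier (path_algebra K G)" for f
    using that by (simp add: path_algebra_simps(1))
  have comb: "(\<lambda>x. c * f x + d * g x) \<in> nf_kernel K" if "f \<in> nf_kernel K" "g \<in> nf_kernel K" for c d f g
    using that lincomb_closed[of f K g c d] by (auto simp: nf_kernel_def fin pairing_lincomb)
  have zero: "\<zero>\<^bsub>path_algebra K G\<^esub> \<in> nf_kernel K"
    by (simp add: nf_kernel_def path_algebra_simps(4) pairing_def)
      (simp add: path_algebra_simps(1))
  show "subgroup (nf_kernel K) (add_monoid (path_algebra K G))"
  proof (rule R.add.subgroupI)
    show "nf_kernel K \<noteq> {}" using zero by auto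
    fix f g assume fg: "f \<in> nf_kernel K" "g \<in> nf_kernel K"
    then show "f \<oplus>\<^bsub>path_algebra K G\<^esub> g \<in> nf_kernel K"
      using comb[of f g 1 1] by (simp add: path_algebra_simps(5))
    have "\<ominus>\<^bsub>path_algebra K G\<^esub> f = (\<lambda>x. 0 * f x + (- 1) * f x)"
      using path_algebra_minus[of "\<zero>\<^bsub>path_algebra K G\<^esub>" K f] fg R.a_inv_closed[of f]
      by (simp add: R.minus_eq nf_kernel_def) (simp add: path_algebra_simps(4))
    then show "\<ominus>\<^bsub>path_algebra K G\<^esub> f \<in> nf_kernel K"
      using comb[OF fg(1,1), of 0 "- 1"] by simp
  qed (auto simp: nf_kernel_def)
next
  fix g f assume g: "g \<in> nf_kernel K" and f: "f \<in> carrier (path_algebra K G)"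
  then have g': "g \<in> carrier (path_algebra K G)" by (simp add: nf_kernel_def)
  have "pairing (f \<otimes>\<^bsub>path_algebra K G\<^esub> g) \<psi> = 0" if \<psi>: "compatible \<psi>" for \<psi>
  proof -
    let ?\<psi> = "\<lambda>z. \<Sum>x\<in>supp f.
      if awlast (fst x) (snd x) = fst z then f x * \<psi> (fst x, snd x @ snd z) else 0"
    have "pairing (f \<otimes>\<^bsub>path_algebra K G\<^esub> g) \<psi> = pairing g ?\<psi>"
      unfolding pairing_mult[OF f g'] unfolding pairing_def sum_distrib_left
      by (subst sum.swap) (intro sum.cong refl, simp)
    then show ?thesis
      using g compatible_left[OF \<psi> f] by (simp add: nf_kernel_def)
  qed
  then show "f \<otimes>\<^bsub>path_algebra K G\<^esub> g \<in> nf_kernel K"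
    using mult_closed[OF f g'] by (simp add: nf_kernel_def)
  have "pairing (g \<otimes>\<^bsub>path_algebra K G\<^esub> f) \<psi> = 0" if \<psi>: "compatible \<psi>" for \<psi>
  proof -
    let ?\<psi> = "\<lambda>x. \<Sum>z\<in>supp f.
      if awlast (fst x) (snd x) = fst z then f z * \<psi> (fst x, snd x @ snd z) else 0"
    have "pairing (g \<otimes>\<^bsub>path_algebra K G\<^esub> f) \<psi> = pairing g ?\<psi>"
      unfolding pairing_mult[OF g' f] unfolding pairing_def sum_distrib_left
      by (intro sum.cong refl) simp
    then show ?thesis
      using g compatible_right[OF \<psi> f] by (simp add: nf_kernel_def)
  qed
  then show "g \<otimes>\<^bsub>path_algebra K G\<^esub> f \<in> nf_kernel K"
    using mult_closed[OF g' f] by (simp add: nf_kernel_def)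
qed

text \<open>These functionals are dual to the normal forms: each extracts the total coefficient of
  the paths that reduce to \<open>y\<close>. They yield the linear independence of normal
  paths.\<close>

lemma compatible_indicator: "compatible (\<lambda>x. if nf x = Some y then 1 else 0)"
  unfolding compatible_def by simp

section \<open>Normal paths as a basis of a corner of the quotient\<close>

lemma supportedD:
  assumes "f \<in> supported K X"
  shows "f \<in> carrier (path_algebra K G)" "supp f \<subseteq> X"
  using assms by (simp_all add: supported_def)

lemma supported_mono: "X \<subseteq> Y \<Longrightarrow> supported K X \<subseteq> supported K Y"
  unfolding supported_def by blast

definition normal_paths :: "'a \<Rightarrow> 'a \<Rightarrow> ('a \<times> 'b list) set" where
  "normal_paths w v = {(u, p) \<in> paths G. u = w \<and> awlast u p = v \<and> nf (u, p) = Some (u, p)}"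

text \<open>Induction over the set of paths takes the place of computing with linear combinations:
  \<open>supported_insert\<close> peels off one term, and \<open>reduce\<close> deletes it or
  replaces it by its normal form without changing the class.\<close>

lemma reduce_supported:
  assumes I: "ideal I (path_algebra K G)"
    and reduce: "\<And>x. x \<in> paths G \<Longrightarrow> (case nf x of None \<Rightarrow> path_elem K x \<in> I
      | Some y \<Rightarrow> path_elem K x \<ominus>\<^bsub>path_algebra K G\<^esub> path_elem K y \<in> I)"
    and X: "finite X" "X \<subseteq> paths G"
    and f: "f \<in> supported K X"
  shows "\<exists>g\<in>supported K {y. \<exists>x\<in>X. nf x = Some y}.
    I +>\<^bsub>path_algebra K G\<^esub> f = I +>\<^bsub>path_algebra K G\<^esub> g"
  using X f
proof (induction X arbitrary: f rule: finite_induct)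
  case empty
  then show ?case by auto
next
  case (insert x X)
  interpret ideal I "path_algebra K G" by (rule I)
  let ?R = "path_algebra K G"
  let ?h = "\<lambda>f. I +>\<^bsub>?R\<^esub> f"
  let ?N = "\<lambda>X. {y. \<exists>x\<in>X. nf x = Some y}"
  interpret h: ring_hom_ring ?R "?R Quot I" ?h by (rule rcos_ring_hom_ring)
  have x: "x \<in> paths G" using insert by auto
  then have e: "path_elem K x \<in> carrier ?R" by (simp add: path_elem_carrier)
  from insert.prems x obtain k f' where k: "k \<in> path_scalars K G" and f': "f' \<in> supported K X"
    and f: "f = k \<otimes>\<^bsub>?R\<^esub> path_elem K x \<oplus>\<^bsub>?R\<^esub> f'"
    by (auto simp: supported_insert line_extension_mem_iff)
  from insert.IH[OF _ f'] insert.prems obtain g' where g': "g' \<in> supported K (?N X)" "?h f' = ?h g'"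
    by auto
  have kc: "k \<in> carrier ?R"
    using k lincomb_closed[OF one_in_carrier one_in_carrier, of _ K 0] by (auto simp: path_scalars_def)
  have carr: "f' \<in> carrier ?R" "g' \<in> carrier ?R"
    using f' g' by (auto simp: supported_def)
  have hf: "?h f = ?h k \<otimes>\<^bsub>?R Quot I\<^esub> ?h (path_elem K x) \<oplus>\<^bsub>?R Quot I\<^esub> ?h g'"
    using kc e carr g'(2) by (simp add: f)
  show ?case
  proof (cases "nf x")
    case None
    then have "path_elem K x \<in> I" using reduce[OF x] by simp
    then have "?h (path_elem K x) = \<zero>\<^bsub>?R Quot I\<^esub>"
      by (simp only: a_rcos_const FactRing_zero)
    then have "?h f = ?h g'" using hf kc carr by simp
    moreover have "g' \<in> supported K (?N (insert x X))"
      by (rule subsetD[OF supported_mono g'(1)]) auto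
    ultimately show ?thesis by (rule bexI)
  next
    case (Some y)
    have y: "y \<in> paths G"
      using nf_path[of "fst x" "snd x" "fst y" "snd y"] x Some by simp
    then have e': "path_elem K y \<in> carrier ?R" by (simp add: path_elem_carrier)
    have d: "path_elem K x \<ominus>\<^bsub>?R\<^esub> path_elem K y \<in> I" using reduce[OF x] Some by simp
    have "path_elem K x = (path_elem K x \<ominus>\<^bsub>?R\<^esub> path_elem K y) \<oplus>\<^bsub>?R\<^esub> path_elem K y"
      using e e' by (simp add: path_algebra_minus) (simp add: path_algebra_simps(5))
    then have "?h (path_elem K x) = ?h (path_elem K x \<ominus>\<^bsub>?R\<^esub> path_elem K y) \<oplus>\<^bsub>?R Quot I\<^esub> ?h (path_elem K y)"
      by (rule trans[OF arg_cong[where f = ?h] h.hom_add[OF a_Hcarr[OF d] e']])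
    moreover have "?h (path_elem K x \<ominus>\<^bsub>?R\<^esub> path_elem K y) = \<zero>\<^bsub>?R Quot I\<^esub>"
      using d by (simp only: a_rcos_const FactRing_zero)
    ultimately have "?h (path_elem K x) = ?h (path_elem K y)"
      using h.S.l_zero[OF h.hom_closed[OF e']] by (simp only:)
    then have "?h f = ?h (k \<otimes>\<^bsub>?R\<^esub> path_elem K y \<oplus>\<^bsub>?R\<^esub> g')"
      using hf kc e' carr by simp
    moreover have N: "insert y (?N X) = ?N (insert x X)"
      using Some by auto
    have "k \<otimes>\<^bsub>?R\<^esub> path_elem K y \<oplus>\<^bsub>?R\<^esub> g' \<in> supported K (?N (insert x X))"
      unfolding N[symmetric] supported_insert[OF y] line_extension_mem_iff using k g' by blast
    ultimately show ?thesis by (rule bexI)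
  qed
qed

text \<open>The quotient map is injective on the span of the normal paths, by \<open>kernel\<close>,
  and maps this span onto the corner cut out by the two idempotents, by \<open>reduce\<close>. The
  dimension is transported along it, with the image of the scalars as ground field.\<close>

lemma cartan_matrix_quotient:
  assumes I: "ideal I (path_algebra K G)"
    and kernel: "I \<subseteq> nf_kernel K"
    and reduce: "\<And>x. x \<in> paths G \<Longrightarrow> (case nf x of None \<Rightarrow> path_elem K x \<in> I
      | Some y \<Rightarrow> path_elem K x \<ominus>\<^bsub>path_algebra K G\<^esub> path_elem K y \<in> I)"
    and vw: "v \<in> verts G" "w \<in> verts G" "nf (w, []) \<noteq> None"
    and fin: "finite (normal_paths w v)"
  shows "cartan_matrix (path_algebra K G Quot I)
      ((\<lambda>f. I +>\<^bsub>path_algebra K G\<^esub> f) ` path_scalars K G)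
      (\<lambda>u. I +>\<^bsub>path_algebra K G\<^esub> path_elem K (u, [])) v w =
    card (normal_paths w v)"
proof -
  let ?B = "normal_paths w v"
  have B_iff: "(u, p) \<in> ?B \<longleftrightarrow> (u, p) \<in> paths G \<and> u = w \<and> awlast u p = v \<and> nf (u, p) = Some (u, p)" for u p
    by (simp add: normal_paths_def)
  have nf_B: "nf x = Some x" if "x \<in> ?B" for x
    using that by (cases x) (simp add: B_iff)
  interpret ideal I "path_algebra K G" by (rule I)
  let ?R = "path_algebra K G"
  let ?h = "\<lambda>f. I +>\<^bsub>?R\<^esub> f"
  interpret h: ring_hom_ring ?R "?R Quot I" ?h by (rule rcos_ring_hom_ring)
  let ?e = "\<lambda>u. path_elem K (u, [])"
  have e: "?e w \<in> carrier ?R" "?e v \<in> carrier ?R"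
    using vw by (simp_all add: path_elem_carrier)
  have B: "?B \<subseteq> paths G" by (auto simp: B_iff)
  \<comment> \<open>Needed for the image of the scalars to be a field. If 1 lay in \<open>I\<close>,
    so would the idempotent at \<open>w\<close>, but the indicator of its normal form takes the
    value 1 on it.\<close>
  have one_zero: "\<one>\<^bsub>?R Quot I\<^esub> \<noteq> \<zero>\<^bsub>?R Quot I\<^esub>"
  proof
    assume "\<one>\<^bsub>?R Quot I\<^esub> = \<zero>\<^bsub>?R Quot I\<^esub>"
    then have "?h \<one>\<^bsub>?R\<^esub> = I" by (simp only: h.hom_one FactRing_zero)
    moreover have "\<one>\<^bsub>?R\<^esub> \<in> ?h \<one>\<^bsub>?R\<^esub>" by (rule a_rcos_self) simp
    ultimately have "\<one>\<^bsub>?R\<^esub> \<in> I" by (simp only:)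
    then have "?e w \<in> I" using I_l_closed[of "\<one>\<^bsub>?R\<^esub>" "?e w"] e by simp
    moreover obtain y where y: "nf (w, []) = Some y" using vw by auto
    ultimately have "pairing (?e w) (\<lambda>x. if nf x = Some y then 1 else 0) = 0"
      using kernel compatible_indicator[of y] unfolding nf_kernel_def by blast
    then show False using y by simp
  qed
  have F: "subfield (path_scalars K G) ?R"
    using vw by (intro path_scalars_subfield) auto
  have inj: "inj_on ?h (supported K ?B)"
  proof (rule inj_onI)
    fix f g assume f: "f \<in> supported K ?B" and g: "g \<in> supported K ?B" and eq: "?h f = ?h g"
    have carr: "f \<in> carrier ?R" "g \<in> carrier ?R" using f g by (auto simp: supported_def)
    have "f \<in> ?h g" using a_rcos_self[OF carr(1)] eq by simp
    then obtain i where i: "i \<in> I" "f = i \<oplus>\<^bsub>?R\<^esub> g"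
      by (auto simp: a_r_coset_def')
    then have i': "i = (\<lambda>x. f x - g x)" by (auto simp: path_algebra_simps(5))
    have out: "f x = 0" "g x = 0" if "x \<notin> ?B" for x
      using that supportedD(2)[OF f] supportedD(2)[OF g] by auto
    have supp_i: "supp i \<subseteq> ?B"
    proof
      fix x assume "x \<in> supp i"
      then have "f x \<noteq> 0 \<or> g x \<noteq> 0" by (auto simp: i')
      then show "x \<in> ?B" using out by blast
    qed
    show "f = g"
    proof
      fix y
      show "f y = g y"
      proof (cases "y \<in> ?B")
        case False
        then show ?thesis by (simp add: out)
      next
        case True
        \<comment> \<open>A normal path is its own normal form, so on elements supported on normal
          paths this functional is the coefficient at \<open>y\<close>.\<close>
        let ?\<psi> = "\<lambda>x. if nf x = Some y then 1 else 0"
        have "i \<in> nf_kernel K" using i(1) kernel by blast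
        then have "pairing i ?\<psi> = 0" by (simp add: nf_kernel_def compatible_indicator)
        moreover have "pairing i ?\<psi> = (\<Sum>x\<in>?B. i x * ?\<psi> x)"
          using supp_i by (rule pairing_superset[OF fin])
        moreover have "\<dots> = (\<Sum>x\<in>?B. if x = y then i y else 0)"
        proof (intro sum.cong refl)
          fix x assume "x \<in> ?B"
          then have "nf x = Some x" by (rule nf_B)
          then show "i x * ?\<psi> x = (if x = y then i y else 0)" by simp
        qed
        moreover have "\<dots> = i y"
          using True fin by simp
        ultimately have "i y = 0" by simp
        then show ?thesis by (simp add: i')
      qed
    qed
  qed
  have img: "?h ` supported K ?B = {?h (?e w) \<otimes>\<^bsub>?R Quot I\<^esub> x \<otimes>\<^bsub>?R Quot I\<^esub> ?h (?e v)
      | x. x \<in> carrier (?R Quot I)}" (is "_ = ?E")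
  proof (intro equalityI subsetI)
    fix c assume "c \<in> ?h ` supported K ?B"
    then obtain f where f: "f \<in> supported K ?B" "c = ?h f" by auto
    then have carr: "f \<in> carrier ?R" by (simp add: supported_def)
    have "?e w \<otimes>\<^bsub>?R\<^esub> f \<otimes>\<^bsub>?R\<^esub> ?e v = f"
    proof
      fix y :: "'a \<times> 'b list"
      obtain u p where y: "y = (u, p)" by fastforce
      show "(?e w \<otimes>\<^bsub>?R\<^esub> f \<otimes>\<^bsub>?R\<^esub> ?e v) y = f y"
        unfolding y idempotent_cut using supportedD(2)[OF f(1)] by (auto simp: B_iff)
    qed
    then have "c = ?h (?e w) \<otimes>\<^bsub>?R Quot I\<^esub> ?h f \<otimes>\<^bsub>?R Quot I\<^esub> ?h (?e v)"
      using f(2) carr e by (metis h.hom_mult m_closed)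
    then show "c \<in> ?E" using h.hom_closed[OF carr] by blast
  next
    fix c assume "c \<in> ?E"
    then obtain X where X: "X \<in> carrier (?R Quot I)"
      and c: "c = ?h (?e w) \<otimes>\<^bsub>?R Quot I\<^esub> X \<otimes>\<^bsub>?R Quot I\<^esub> ?h (?e v)" by auto
    from X obtain x where x: "x \<in> carrier ?R" "X = ?h x"
      unfolding FactRing_carrier by auto
    \<comment> \<open>Cutting the representative by the idempotents before reducing it leaves only
      paths from \<open>w\<close> to \<open>v\<close>. Normal forms keep endpoints, so the reduction
      stays in the required span.\<close>
    define f where "f = ?e w \<otimes>\<^bsub>?R\<^esub> x \<otimes>\<^bsub>?R\<^esub> ?e v"
    have f: "f \<in> carrier ?R" "c = ?h f"
      using x e by (simp_all add: f_def c)
    then have sf: "finite (supp f)" "supp f \<subseteq> paths G" "f \<in> supported K (supp f)"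
      by (auto simp: path_algebra_simps(1) supported_def)
    obtain g where g: "g \<in> supported K {y. \<exists>x\<in>supp f. nf x = Some y}" "?h f = ?h g"
      using reduce_supported[OF I reduce sf] by auto
    have "{y. \<exists>x\<in>supp f. nf x = Some y} \<subseteq> ?B"
    proof
      fix y assume "y \<in> {y. \<exists>x\<in>supp f. nf x = Some y}"
      then obtain x where x: "x \<in> supp f" "nf x = Some y" by blast
      obtain u p where up: "x = (u, p)" by fastforce
      obtain a b where ab: "y = (a, b)" by fastforce
      from x have "f (u, p) \<noteq> 0" by (simp add: up)
      moreover from this have "(u, p) \<in> paths G"
        using sf(2) by auto
      ultimately have u: "u = w" "awlast u p = v" "(u, p) \<in> paths G"
        unfolding f_def idempotent_cut by (auto split: if_splits)
      have nf: "nf (u, p) = Some (a, b)" using x(2) by (simp only: up ab)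
      show "y \<in> ?B"
        using nf_path[OF u(3) nf] nf_idem[OF u(3) nf] u(1,2) unfolding ab B_iff by metis
    qed
    from subsetD[OF supported_mono[OF this] g(1)] have "g \<in> supported K ?B" .
    then show "c \<in> ?h ` supported K ?B" using f(2) g(2) by blast
  qed
  have "h.S.dimension (card ?B) (?h ` path_scalars K G) (?h ` supported K ?B)"
    by (rule h.inj_hom_dimension[OF F one_zero inj dimension_supported[OF fin B]])
  then have "((h.S.dim over (?h ` path_scalars K G)) ?E) = card ?B"
    unfolding img by (rule h.S.dimI[OF h.img_is_subfield(2)[OF F one_zero]])
  then show ?thesis
    by (simp add: cartan_matrix_def over_def)
qed

end

section \<open>Normal forms in Brauer configuration algebras\<close>

lemma not_successively_split:
  "\<not> successively P xs \<Longrightarrow> \<exists>ys a b zs. xs = ys @ [a, b] @ zs \<and> \<not> P a b"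
proof (induction xs)
  case (Cons x xs)
  show ?case
  proof (cases "successively P xs")
    case True
    with Cons.prems have "xs \<noteq> []" "\<not> P x (hd xs)" by (auto simp: successively_Cons)
    then have "x # xs = [] @ [x, hd xs] @ tl xs \<and> \<not> P x (hd xs)" by simp
    then show ?thesis by blast
  next
    case False
    with Cons.IH obtain ys a b zs where "xs = ys @ [a, b] @ zs" "\<not> P a b" by blast
    then have "x # xs = (x # ys) @ [a, b] @ zs \<and> \<not> P a b" by simp
    then show ?thesis by blast
  qed
qed simp

section \<open>Runs along special cycles\<close>

definition next_arrow :: "('a, 'p) brauer_config \<Rightarrow> 'a \<times> nat \<Rightarrow> 'a \<times> nat" where
  "next_arrow \<Gamma> a = (fst a, Suc (snd a) mod val \<Gamma> (fst a))"

text \<open>Special cycles, their powers and all subpaths of these powers have this one form, given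
  by a first arrow and a length. It replaces rotations and repeated concatenation.\<close>

primrec arrow_run :: "('a, 'p) brauer_config \<Rightarrow> 'a \<times> nat \<Rightarrow> nat \<Rightarrow> ('a \<times> nat) list" where
  "arrow_run \<Gamma> a 0 = []"
| "arrow_run \<Gamma> a (Suc m) = a # arrow_run \<Gamma> (next_arrow \<Gamma> a) m"

abbreviation special :: "('a, 'p) brauer_config \<Rightarrow> ('a \<times> nat) list \<Rightarrow> bool" where
  "special \<Gamma> \<equiv> successively (\<lambda>a b. b = next_arrow \<Gamma> a)"

definition full_length :: "('a, 'p) brauer_config \<Rightarrow> 'a \<Rightarrow> nat" where
  "full_length \<Gamma> \<alpha> = bc_mult \<Gamma> \<alpha> * val \<Gamma> \<alpha>"

text \<open>On paths of the quiver these are the powers of special cycles that the type one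
  relations identify. The length is compared at the first arrow, since all arrows of a special list
  belong to the same vertex.\<close>

definition full :: "('a, 'p) brauer_config \<Rightarrow> ('a \<times> nat) list \<Rightarrow> bool" where
  "full \<Gamma> p \<longleftrightarrow> p \<noteq> [] \<and> special \<Gamma> p \<and> length p = full_length \<Gamma> (fst (hd p))"

definition bounded :: "('a, 'p) brauer_config \<Rightarrow> ('a \<times> nat) list \<Rightarrow> bool" where
  "bounded \<Gamma> p \<longleftrightarrow> p = [] \<or> special \<Gamma> p \<and> length p \<le> full_length \<Gamma> (fst (hd p))"

lemma length_arrow_run [simp]: "length (arrow_run \<Gamma> a m) = m"
  by (induction m arbitrary: a) auto

lemma arrow_run_eq_Nil [simp]: "arrow_run \<Gamma> a m = [] \<longleftrightarrow> m = 0"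
  by (cases m) auto

lemma hd_arrow_run [simp]: "m > 0 \<Longrightarrow> hd (arrow_run \<Gamma> a m) = a"
  by (cases m) auto

lemma nth_arrow_run: "i < m \<Longrightarrow> arrow_run \<Gamma> a m ! i = (next_arrow \<Gamma> ^^ i) a"
proof (induction m arbitrary: a i)
  case (Suc m)
  then show ?case by (cases i) (auto simp: funpow_swap1)
qed simp

lemma arrow_run_add:
  "arrow_run \<Gamma> a (m + n) = arrow_run \<Gamma> a m @ arrow_run \<Gamma> ((next_arrow \<Gamma> ^^ m) a) n"
  by (induction m arbitrary: a) (auto simp: funpow_swap1)

lemma special_arrow_run: "special \<Gamma> (arrow_run \<Gamma> a m)"
proof (induction m arbitrary: a)
  case (Suc m)
  then show ?case by (cases m) (auto simp: successively_Cons)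
qed simp

lemma special_imp_arrow_run: "special \<Gamma> p \<Longrightarrow> p \<noteq> [] \<Longrightarrow> p = arrow_run \<Gamma> (hd p) (length p)"
proof (induction p)
  case (Cons a p)
  then show ?case by (cases p) (auto simp: successively_Cons)
qed simp

lemma fst_funpow_next_arrow [simp]: "fst ((next_arrow \<Gamma> ^^ i) a) = fst a"
  by (induction i) (auto simp: next_arrow_def)

lemma funpow_next_arrow:
  "l < val \<Gamma> \<alpha> \<Longrightarrow> (next_arrow \<Gamma> ^^ i) (\<alpha>, l) = (\<alpha>, (l + i) mod val \<Gamma> \<alpha>)"
  by (induction i) (auto simp: next_arrow_def mod_Suc_eq)

text \<open>A special list stays within one vertex, so \<open>p\<close>, \<open>q\<close> and
  \<open>p @ q\<close> are measured against the same bound, and a nonempty proper piece is strictly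
  shorter than it. Read backwards: a full run extended at either end is no longer bounded.\<close>

lemma bounded_append:
  assumes "bounded \<Gamma> (p @ q)"
  shows "bounded \<Gamma> p" "bounded \<Gamma> q" "p \<noteq> [] \<Longrightarrow> q \<noteq> [] \<Longrightarrow> \<not> full \<Gamma> p \<and> \<not> full \<Gamma> q"
proof -
  have "bounded \<Gamma> p \<and> bounded \<Gamma> q \<and> (p \<noteq> [] \<longrightarrow> q \<noteq> [] \<longrightarrow> \<not> full \<Gamma> p \<and> \<not> full \<Gamma> q)"
  proof (cases "p = [] \<or> q = []")
    case True
    then show ?thesis using assms by (auto simp: bounded_def)
  next
    case False
    then have s: "special \<Gamma> p" "special \<Gamma> q" and hq: "hd q = next_arrow \<Gamma> (last p)"
      using assms by (auto simp: bounded_def successively_append_iff)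
    \<comment> \<open>The last arrow is an iterated successor of the first, and passing to the
      successor keeps the vertex.\<close>
    have "last p = (next_arrow \<Gamma> ^^ (length p - 1)) (hd p)"
      using False special_imp_arrow_run[OF s(1)] nth_arrow_run[of "length p - 1" "length p" \<Gamma> "hd p"]
      by (simp add: last_conv_nth)
    then have "fst (hd q) = fst (hd p)"
      by (simp add: hq next_arrow_def)
    then show ?thesis
      using False assms s by (auto simp: bounded_def full_def)
  qed
  then show "bounded \<Gamma> p" "bounded \<Gamma> q" "p \<noteq> [] \<Longrightarrow> q \<noteq> [] \<Longrightarrow> \<not> full \<Gamma> p \<and> \<not> full \<Gamma> q"
    by auto
qed

lemma full_imp_bounded: "full \<Gamma> p \<Longrightarrow> bounded \<Gamma> p"
  by (simp add: full_def bounded_def)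

lemma special_cycle_arrow_run:
  assumes "l < val \<Gamma> \<alpha>"
  shows "special_cycle \<Gamma> \<alpha> l = arrow_run \<Gamma> (\<alpha>, l) (val \<Gamma> \<alpha>)"
  by (rule nth_equalityI)
    (simp_all add: special_cycle_def nth_rotate nth_arrow_run funpow_next_arrow assms)

text \<open>After \<open>val\<close> steps the run is back at its first arrow, so the next copy of
  the cycle continues it.\<close>

lemma cycle_power_arrow_run:
  assumes "l < val \<Gamma> \<alpha>"
  shows "cycle_power k (special_cycle \<Gamma> \<alpha> l) = arrow_run \<Gamma> (\<alpha>, l) (k * val \<Gamma> \<alpha>)"
proof (induction k)
  case (Suc k)
  have "arrow_run \<Gamma> (\<alpha>, l) (val \<Gamma> \<alpha> + k * val \<Gamma> \<alpha>) =
      arrow_run \<Gamma> (\<alpha>, l) (val \<Gamma> \<alpha>) @ arrow_run \<Gamma> (\<alpha>, l) (k * val \<Gamma> \<alpha>)"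
    using assms by (simp add: arrow_run_add funpow_next_arrow)
  then show ?case
    using Suc assms by (simp add: cycle_power_def special_cycle_arrow_run)
qed (simp add: cycle_power_def)

section \<open>The quiver of a Brauer configuration and its full runs\<close>

context brauer_configuration
begin

abbreviation Q :: "('p, 'a \<times> nat) pre_digraph" where "Q \<equiv> bc_quiver \<Gamma>"

lemma verts_Q [simp]: "verts Q = bc_polygons \<Gamma>"
  by (simp add: bc_quiver_def)

lemma arcs_Q_iff:
  "a \<in> arcs Q \<longleftrightarrow> fst a \<in> bc_vertices \<Gamma> \<and> \<not> truncated \<Gamma> (fst a) \<and> snd a < val \<Gamma> (fst a)"
  by (cases a) (simp add: bc_quiver_def)

lemma tail_Q: "tail Q (\<alpha>, j) = bc_succ \<Gamma> \<alpha> ! j"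
  by (simp add: bc_quiver_def)

lemma head_Q: "head Q a = tail Q (next_arrow \<Gamma> a)"
  by (cases a) (simp add: bc_quiver_def next_arrow_def)

lemma next_arrow_arcs: "a \<in> arcs Q \<Longrightarrow> next_arrow \<Gamma> a \<in> arcs Q"
  by (auto simp: arcs_Q_iff next_arrow_def)

text \<open>The orientation prescribes how often each polygon occurs in the list. Summing these
  counts shows that the arrow numbers below \<open>val\<close> are exactly the valid positions, so
  every tail and head is an entry of the list.\<close>

lemma length_succ:
  assumes "\<alpha> \<in> bc_vertices \<Gamma>" "\<not> truncated \<Gamma> \<alpha>"
  shows "length (bc_succ \<Gamma> \<alpha>) = val \<Gamma> \<alpha>"
proof -
  let ?M = "mset (bc_succ \<Gamma> \<alpha>)"
  have sub: "set_mset ?M \<subseteq> bc_polygons \<Gamma>"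
  proof
    fix V assume "V \<in># ?M"
    then have "count ?M V \<noteq> 0" by (metis count_eq_zero_iff)
    then show "V \<in> bc_polygons \<Gamma>" unfolding orientation[OF assms] by (meson)
  qed
  have "length (bc_succ \<Gamma> \<alpha>) = size ?M" by simp
  also have "\<dots> = (\<Sum>V\<in>set_mset ?M. count ?M V)" by (rule size_multiset_overloaded_eq)
  also have "\<dots> = (\<Sum>V\<in>bc_polygons \<Gamma>. count ?M V)"
    using sub finite_polygons by (intro sum.mono_neutral_left) (auto simp: not_in_iff)
  also have "\<dots> = val \<Gamma> \<alpha>"
    unfolding val_def orientation[OF assms] by (intro sum.cong) auto
  finally show ?thesis .
qed

lemma tail_Q_polygon:
  assumes "a \<in> arcs Q"
  shows "tail Q a \<in> bc_polygons \<Gamma>" "fst a \<in> polygon_vertices \<Gamma> (tail Q a)"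
proof -
  obtain \<alpha> j where a: "a = (\<alpha>, j)" by fastforce
  have \<alpha>: "\<alpha> \<in> bc_vertices \<Gamma>" "\<not> truncated \<Gamma> \<alpha>" "j < val \<Gamma> \<alpha>"
    using assms by (auto simp: a arcs_Q_iff)
  then have "tail Q a \<in> set (bc_succ \<Gamma> \<alpha>)"
    by (simp add: a tail_Q length_succ)
  then have "count (mset (bc_succ \<Gamma> \<alpha>)) (tail Q a) \<noteq> 0"
    by (simp add: count_mset_0_iff)
  then have "tail Q a \<in> bc_polygons \<Gamma> \<and> occ \<Gamma> \<alpha> (tail Q a) \<noteq> 0"
    unfolding orientation[OF \<alpha>(1,2)] by (meson)
  then show "tail Q a \<in> bc_polygons \<Gamma>" "fst a \<in> polygon_vertices \<Gamma> (tail Q a)"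
    by (simp_all add: occ_def a count_eq_zero_iff)
qed

lemma fin_digraph_Q: "fin_digraph Q"
proof
  have "arcs Q \<subseteq> Sigma (bc_vertices \<Gamma>) (\<lambda>\<alpha>. {..<val \<Gamma> \<alpha>})"
    by (auto simp: arcs_Q_iff)
  then show "finite (arcs Q)"
    by (rule finite_subset) (simp add: finite_vertices)
qed (simp_all add: tail_Q_polygon head_Q next_arrow_arcs finite_polygons)

sublocale Q: fin_digraph Q by (rule fin_digraph_Q)

lemma awalk_arrow_run:
  assumes "a \<in> arcs Q"
  shows "Q.awalk (tail Q a) (arrow_run \<Gamma> a m) (tail Q ((next_arrow \<Gamma> ^^ m) a))"
  using assms
proof (induction m arbitrary: a)
  case 0
  then show ?case by (simp add: Q.awalk_Nil_iff tail_Q_polygon)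
next
  case (Suc m)
  then show ?case
    by (simp add: Q.awalk_Cons_iff head_Q next_arrow_arcs funpow_swap1)
qed

lemma arrow_run_path:
  assumes "a \<in> arcs Q"
  shows "(tail Q a, arrow_run \<Gamma> a m) \<in> paths Q"
    "Q.awlast (tail Q a) (arrow_run \<Gamma> a m) = tail Q ((next_arrow \<Gamma> ^^ m) a)"
  using awalk_arrow_run[OF assms, of m] by (auto simp: paths_def)

lemma path_hd:
  assumes "(u, p) \<in> paths Q" "p \<noteq> []"
  shows "hd p \<in> arcs Q" "tail Q (hd p) = u"
  using assms by (cases p; auto simp: paths_def Q.awalk_Cons_iff)+

lemma full_length_gt_1:
  assumes "a \<in> arcs Q"
  shows "full_length \<Gamma> (fst a) > 1"
proof -
  have "val \<Gamma> (fst a) > 0" "bc_mult \<Gamma> (fst a) > 0" "\<not> (val \<Gamma> (fst a) = 1 \<and> bc_mult \<Gamma> (fst a) = 1)"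
    using assms mult_pos by (auto simp: arcs_Q_iff truncated_def)
  then show ?thesis
    unfolding full_length_def by (metis One_nat_def Suc_lessI mult_eq_1_iff nat_0_less_mult_iff)
qed

lemma funpow_full_length:
  assumes "a \<in> arcs Q"
  shows "(next_arrow \<Gamma> ^^ full_length \<Gamma> (fst a)) a = a"
  using assms by (cases a) (auto simp: arcs_Q_iff funpow_next_arrow full_length_def)

lemma full_path:
  assumes "(u, p) \<in> paths Q" "full \<Gamma> p"
  shows "Q.awlast u p = u" "p = arrow_run \<Gamma> (hd p) (full_length \<Gamma> (fst (hd p)))"
proof -
  have p: "p \<noteq> []" "special \<Gamma> p" "length p = full_length \<Gamma> (fst (hd p))"
    using assms(2) by (auto simp: full_def)
  show eq: "p = arrow_run \<Gamma> (hd p) (full_length \<Gamma> (fst (hd p)))"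
    using special_imp_arrow_run[OF p(2,1)] p(3) by simp
  have "Q.awlast (tail Q (hd p)) (arrow_run \<Gamma> (hd p) (full_length \<Gamma> (fst (hd p)))) = tail Q (hd p)"
    using arrow_run_path(2)[OF path_hd(1)[OF assms(1) p(1)]] funpow_full_length[OF path_hd(1)[OF assms(1) p(1)]]
    by simp
  then show "Q.awlast u p = u"
    using path_hd(2)[OF assms(1) p(1)] eq by simp
qed

lemma full_arrow_run: "a \<in> arcs Q \<Longrightarrow> full \<Gamma> (arrow_run \<Gamma> a (full_length \<Gamma> (fst a)))"
  using full_length_gt_1[of a] by (auto simp: full_def special_arrow_run)

text \<open>Any full run starting at \<open>V\<close> will do: the type one relations give all of
  them the same class.\<close>

definition socle_path :: "'p \<Rightarrow> ('a \<times> nat) list" where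
  "socle_path V = (SOME p. (V, p) \<in> paths Q \<and> full \<Gamma> p)"

text \<open>Existence rests on \<open>polygon_nontruncated\<close>. The vertex it supplies is not
  truncated, and its occurrence in \<open>V\<close> gives a position of the successor list, that is,
  an arrow leaving \<open>V\<close> from which a full run can start.\<close>

lemma socle_path:
  assumes "V \<in> bc_polygons \<Gamma>"
  shows "(V, socle_path V) \<in> paths Q" "full \<Gamma> (socle_path V)"
proof -
  obtain \<alpha> where \<alpha>: "\<alpha> \<in> polygon_vertices \<Gamma> V" "val \<Gamma> \<alpha> * bc_mult \<Gamma> \<alpha> > 1"
    using polygon_nontruncated[OF assms] by auto
  then have v: "\<alpha> \<in> bc_vertices \<Gamma>" "\<not> truncated \<Gamma> \<alpha>"
    using polygon_vertices_subset[OF assms] by (auto simp: truncated_def)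
  have "count (mset (bc_succ \<Gamma> \<alpha>)) V \<noteq> 0"
    unfolding orientation[OF v] using assms \<alpha>(1) by (simp add: occ_def)
  then have "V \<in> set (bc_succ \<Gamma> \<alpha>)" by (simp add: count_mset_0_iff)
  then obtain j where j: "j < val \<Gamma> \<alpha>" "bc_succ \<Gamma> \<alpha> ! j = V"
    by (auto simp: in_set_conv_nth length_succ[OF v])
  then have a: "(\<alpha>, j) \<in> arcs Q" "tail Q (\<alpha>, j) = V" using v by (simp_all add: arcs_Q_iff tail_Q)
  then have "(V, arrow_run \<Gamma> (\<alpha>, j) (full_length \<Gamma> \<alpha>)) \<in> paths Q \<and>
      full \<Gamma> (arrow_run \<Gamma> (\<alpha>, j) (full_length \<Gamma> \<alpha>))"
    using arrow_run_path(1)[OF a(1)] full_arrow_run[OF a(1)] by simp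
  then have "(V, socle_path V) \<in> paths Q \<and> full \<Gamma> (socle_path V)"
    unfolding socle_path_def by (rule someI)
  then show "(V, socle_path V) \<in> paths Q" "full \<Gamma> (socle_path V)" by auto
qed

section \<open>The normal form of a path\<close>

definition brauer_nf :: "'p \<times> ('a \<times> nat) list \<Rightarrow> ('p \<times> ('a \<times> nat) list) option" where
  "brauer_nf x = (if \<not> bounded \<Gamma> (snd x) then None
    else if full \<Gamma> (snd x) then Some (fst x, socle_path (fst x)) else Some x)"

text \<open>The chosen socle path is itself full, so a path that is bounded but not full shares its
  normal form with no other path from the same start.\<close>

lemma brauer_nf_eqD:
  assumes "u \<in> bc_polygons \<Gamma>" "brauer_nf (u, p) = brauer_nf (u, q)"
  shows "p = q \<or> \<not> bounded \<Gamma> p \<and> \<not> bounded \<Gamma> q \<or> full \<Gamma> p \<and> full \<Gamma> q"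
  using assms socle_path(2)[OF assms(1)] by (auto simp: brauer_nf_def split: if_splits)

lemma brauer_nf_None: "brauer_nf x = None \<longleftrightarrow> \<not> bounded \<Gamma> (snd x)"
  by (simp add: brauer_nf_def)

lemma brauer_nf_full: "full \<Gamma> p \<Longrightarrow> brauer_nf (u, p) = Some (u, socle_path u)"
  by (simp add: brauer_nf_def full_imp_bounded)

text \<open>Different factors with equal normal form are both unbounded or both full. Unbounded
  factors make both concatenations unbounded; full ones do so when the other factor is nonempty, and
  for an empty one the claim is the hypothesis. Endpoints are kept because full runs are
  closed.\<close>

sublocale path_rewriting Q brauer_nf
proof
  fix u p v q assume up: "(u, p) \<in> paths Q" and nf: "brauer_nf (u, p) = Some (v, q)"
  have u: "u \<in> bc_polygons \<Gamma>" using Q.paths_start[OF up] by simp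
  show "(v, q) \<in> paths Q \<and> v = u \<and> Q.awlast v q = Q.awlast u p"
    using nf up full_path(1)[OF up] socle_path[OF u] full_path(1)[OF socle_path[OF u]]
    by (auto simp: brauer_nf_def split: if_splits)
next
  fix x y assume x: "x \<in> paths Q" and nf: "brauer_nf x = Some y"
  have u: "fst x \<in> bc_polygons \<Gamma>" using Q.paths_start[of "fst x" "snd x"] x by simp
  show "brauer_nf y = Some y"
    using nf socle_path[OF u] full_imp_bounded[OF socle_path(2)[OF u]]
    by (auto simp: brauer_nf_def split: if_splits)
next
  fix u p q assume "brauer_nf (Q.awlast u p, q) = None"
  then show "brauer_nf (u, p @ q) = None"
    using bounded_append(2)[of \<Gamma> p q] by (auto simp: brauer_nf_None)
next
  fix u p q assume "brauer_nf (u, p) = None"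
  then show "brauer_nf (u, p @ q) = None"
    using bounded_append(1)[of \<Gamma> p q] by (auto simp: brauer_nf_None)
next
  fix u p q q' assume pq: "(u, p @ q) \<in> paths Q" "(u, p @ q') \<in> paths Q"
    and nf: "brauer_nf (Q.awlast u p, q) = brauer_nf (Q.awlast u p, q')"
  have "Q.awlast u p \<in> bc_polygons \<Gamma>"
    using pq(1) Q.paths_end by (auto simp: Q.paths_append_iff)
  from brauer_nf_eqD[OF this nf] consider "q = q'" | "\<not> bounded \<Gamma> q" "\<not> bounded \<Gamma> q'"
    | "full \<Gamma> q" "full \<Gamma> q'" by blast
  then show "brauer_nf (u, p @ q) = brauer_nf (u, p @ q')"
  proof cases
    case 2
    then have "\<not> bounded \<Gamma> (p @ q)" "\<not> bounded \<Gamma> (p @ q')" using bounded_append(2) by blast+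
    then show ?thesis by (simp add: brauer_nf_def)
  next
    case 3
    then have ne: "q \<noteq> []" "q' \<noteq> []" by (auto simp: full_def)
    show ?thesis
    proof (cases "p = []")
      case False
      then have "\<not> bounded \<Gamma> (p @ q)" "\<not> bounded \<Gamma> (p @ q')"
        using bounded_append(3) ne 3 by blast+
      then show ?thesis by (simp add: brauer_nf_def)
    qed (use nf in simp)
  qed simp
next
  fix u p q p' assume pq: "(u, p @ q) \<in> paths Q" "(u, p' @ q) \<in> paths Q"
    and nf: "brauer_nf (u, p) = brauer_nf (u, p')"
  have "u \<in> bc_polygons \<Gamma>"
    using pq(1) Q.paths_start by auto
  from brauer_nf_eqD[OF this nf] consider "p = p'" | "\<not> bounded \<Gamma> p" "\<not> bounded \<Gamma> p'"
    | "full \<Gamma> p" "full \<Gamma> p'" by blast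
  then show "brauer_nf (u, p @ q) = brauer_nf (u, p' @ q)"
  proof cases
    case 2
    then have "\<not> bounded \<Gamma> (p @ q)" "\<not> bounded \<Gamma> (p' @ q)" using bounded_append(1) by blast+
    then show ?thesis by (simp add: brauer_nf_def)
  next
    case 3
    then have ne: "p \<noteq> []" "p' \<noteq> []" by (auto simp: full_def)
    show ?thesis
    proof (cases "q = []")
      case False
      then have "\<not> bounded \<Gamma> (p @ q)" "\<not> bounded \<Gamma> (p' @ q)"
        using bounded_append(3) ne 3 by blast+
      then show ?thesis by (simp add: brauer_nf_def)
    qed (use nf in simp)
  qed simp
qed

section \<open>The relations in terms of runs\<close>

lemma special_cycles_at_iff:
  assumes "V \<in> bc_polygons \<Gamma>"
  shows "\<alpha> \<in> nontruncated_in \<Gamma> (polygon_vertices \<Gamma> V) \<and> C \<in> special_cycles_at \<Gamma> \<alpha> V \<longleftrightarrow>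
    (\<exists>l. (\<alpha>, l) \<in> arcs Q \<and> tail Q (\<alpha>, l) = V \<and> C = special_cycle \<Gamma> \<alpha> l)" (is "?L \<longleftrightarrow> ?R")
proof
  assume L: ?L
  then obtain l where l: "l < val \<Gamma> \<alpha>" "C = special_cycle \<Gamma> \<alpha> l" "tail Q (hd C) = V"
    by (auto simp: special_cycles_at_def special_cycles_def)
  then have "tail Q (\<alpha>, l) = V"
    by (simp add: special_cycle_arrow_run)
  moreover have "(\<alpha>, l) \<in> arcs Q"
    using L l(1) polygon_vertices_subset[OF assms] by (auto simp: arcs_Q_iff nontruncated_in_def)
  ultimately show ?R using l(2) by blast
next
  assume ?R
  then obtain l where l: "(\<alpha>, l) \<in> arcs Q" "tail Q (\<alpha>, l) = V" "C = special_cycle \<Gamma> \<alpha> l"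
    by blast
  then have l': "l < val \<Gamma> \<alpha>" "\<not> truncated \<Gamma> \<alpha>" by (auto simp: arcs_Q_iff)
  have "\<alpha> \<in> polygon_vertices \<Gamma> V" using tail_Q_polygon(2)[OF l(1)] l(2) by simp
  moreover have "tail Q (hd C) = V"
    using l l' by (simp add: special_cycle_arrow_run)
  ultimately show ?L
    using l(3) l' by (auto simp: nontruncated_in_def special_cycles_at_def special_cycles_def)
qed

lemma special_cycle_power:
  assumes "(\<alpha>, l) \<in> arcs Q"
  shows "cycle_power (bc_mult \<Gamma> \<alpha>) (special_cycle \<Gamma> \<alpha> l) = arrow_run \<Gamma> (\<alpha>, l) (full_length \<Gamma> \<alpha>)"
  using assms by (simp add: arcs_Q_iff cycle_power_arrow_run full_length_def)

text \<open>A full path at \<open>V\<close> determines the vertex and the cycle by its first arrow,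
  and every arrow leaving \<open>V\<close> starts a full run. Choosing a nontruncated vertex and a
  special cycle at \<open>V\<close> thus amounts to choosing a full path.\<close>

lemma relations_one_eq:
  "relations_one K \<Gamma> =
    {path_elem K (V, p) \<ominus>\<^bsub>path_algebra K Q\<^esub> path_elem K (V, q) | V p q.
      (V, p) \<in> paths Q \<and> full \<Gamma> p \<and> (V, q) \<in> paths Q \<and> full \<Gamma> q}"
proof -
  have iff: "(V, p) \<in> paths Q \<and> full \<Gamma> p \<longleftrightarrow>
      (\<exists>\<alpha> C. \<alpha> \<in> nontruncated_in \<Gamma> (polygon_vertices \<Gamma> V) \<and> C \<in> special_cycles_at \<Gamma> \<alpha> V
        \<and> p = cycle_power (bc_mult \<Gamma> \<alpha>) C)" (is "?L \<longleftrightarrow> ?R")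
    if V: "V \<in> bc_polygons \<Gamma>" for V p
  proof
    assume L: ?L
    then have p: "p \<noteq> []" by (simp add: full_def)
    obtain \<alpha> l where h: "hd p = (\<alpha>, l)" by fastforce
    have a: "(\<alpha>, l) \<in> arcs Q" "tail Q (\<alpha>, l) = V"
      using path_hd[of V p] L p by (simp_all add: h)
    then have "p = cycle_power (bc_mult \<Gamma> \<alpha>) (special_cycle \<Gamma> \<alpha> l)"
      using full_path(2)[of V p] L h by (simp add: special_cycle_power)
    then show ?R
      using special_cycles_at_iff[OF V, of \<alpha> "special_cycle \<Gamma> \<alpha> l"] a by blast
  next
    assume ?R
    then obtain \<alpha> C where C: "\<alpha> \<in> nontruncated_in \<Gamma> (polygon_vertices \<Gamma> V) \<and> C \<in> special_cycles_at \<Gamma> \<alpha> V"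
      and p: "p = cycle_power (bc_mult \<Gamma> \<alpha>) C"
      by blast
    from C obtain l where a: "(\<alpha>, l) \<in> arcs Q" "tail Q (\<alpha>, l) = V" and "C = special_cycle \<Gamma> \<alpha> l"
      unfolding special_cycles_at_iff[OF V] by blast
    then show ?L using p
      using arrow_run_path(1)[OF a(1), of "full_length \<Gamma> \<alpha>"] full_arrow_run[OF a(1)]
      by (simp add: special_cycle_power)
  qed
  show ?thesis
  proof (intro equalityI subsetI)
    fix x assume "x \<in> relations_one K \<Gamma>"
    then show "x \<in> {path_elem K (V, p) \<ominus>\<^bsub>path_algebra K Q\<^esub> path_elem K (V, q) | V p q.
      (V, p) \<in> paths Q \<and> full \<Gamma> p \<and> (V, q) \<in> paths Q \<and> full \<Gamma> q}"
      unfolding relations_one_def using iff by blast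
  next
    fix x assume "x \<in> {path_elem K (V, p) \<ominus>\<^bsub>path_algebra K Q\<^esub> path_elem K (V, q) | V p q.
      (V, p) \<in> paths Q \<and> full \<Gamma> p \<and> (V, q) \<in> paths Q \<and> full \<Gamma> q}"
    then obtain V p q where x: "x = path_elem K (V, p) \<ominus>\<^bsub>path_algebra K Q\<^esub> path_elem K (V, q)"
      and pq: "(V, p) \<in> paths Q \<and> full \<Gamma> p" "(V, q) \<in> paths Q \<and> full \<Gamma> q" by blast
    have "V \<in> bc_polygons \<Gamma>" using pq(1) Q.paths_start by auto
    with pq show "x \<in> relations_one K \<Gamma>"
      unfolding x relations_one_def iff[OF \<open>V \<in> bc_polygons \<Gamma>\<close>] by blast
  qed
qed

text \<open>The arrow that follows a run of full length is its first arrow, so appending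
  \<open>hd C\<close> prolongs the run by one step.\<close>

lemma relations_two_eq:
  "relations_two K \<Gamma> =
    {path_elem K (tail Q a, arrow_run \<Gamma> a (full_length \<Gamma> (fst a) + 1)) | a. a \<in> arcs Q}"
proof -
  have run: "cycle_power (bc_mult \<Gamma> \<alpha>) (special_cycle \<Gamma> \<alpha> l) @ [hd (special_cycle \<Gamma> \<alpha> l)] =
      arrow_run \<Gamma> (\<alpha>, l) (full_length \<Gamma> \<alpha> + 1)"
    and hd: "hd (special_cycle \<Gamma> \<alpha> l) = (\<alpha>, l)"
    if a: "(\<alpha>, l) \<in> arcs Q" for \<alpha> l
  proof -
    have l: "l < val \<Gamma> \<alpha>" using a by (simp add: arcs_Q_iff)
    then show hd: "hd (special_cycle \<Gamma> \<alpha> l) = (\<alpha>, l)"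
      by (simp add: special_cycle_arrow_run)
    show "cycle_power (bc_mult \<Gamma> \<alpha>) (special_cycle \<Gamma> \<alpha> l) @ [hd (special_cycle \<Gamma> \<alpha> l)] =
      arrow_run \<Gamma> (\<alpha>, l) (full_length \<Gamma> \<alpha> + 1)"
      unfolding hd special_cycle_power[OF a] arrow_run_add
      using funpow_full_length[OF a] by simp
  qed
  have arc: "\<alpha> \<in> nontruncated_in \<Gamma> (bc_vertices \<Gamma>) \<and> C \<in> special_cycles \<Gamma> \<alpha> \<longleftrightarrow>
      (\<exists>l. (\<alpha>, l) \<in> arcs Q \<and> C = special_cycle \<Gamma> \<alpha> l)" for \<alpha> C
    by (auto simp: nontruncated_in_def special_cycles_def arcs_Q_iff)
  show ?thesis
    unfolding relations_two_def arc using run hd by (force simp: split_paired_Ex)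
qed

text \<open>If \<open>val\<close> is at least 2, an arrow and its successor are adjacent on the
  special cycle that starts with this arrow. If \<open>val\<close> is 1, the special cycle is a
  single loop and contains no pair; the exempted squares fill exactly this gap, since a nontruncated
  vertex of valency 1 has \<mu>(\<alpha>) > 1.\<close>

lemma relations_three_eq:
  "relations_three K \<Gamma> =
    {path_elem K (v, [a, b]) | v a b. (v, [a, b]) \<in> paths Q \<and> b \<noteq> next_arrow \<Gamma> a}"
proof -
  have iff: "\<not> (\<exists>\<alpha>\<in>nontruncated_in \<Gamma> (bc_vertices \<Gamma>). \<exists>C\<in>special_cycles \<Gamma> \<alpha>. sublist [a, b] C) \<and>
      \<not> (\<exists>\<alpha>. val \<Gamma> \<alpha> = 1 \<and> bc_mult \<Gamma> \<alpha> > 1 \<and> a = (\<alpha>, 0) \<and> b = (\<alpha>, 0)) \<longleftrightarrow>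
      b \<noteq> next_arrow \<Gamma> a" (is "\<not> ?S \<and> \<not> ?E \<longleftrightarrow> _")
    if path: "(v, [a, b]) \<in> paths Q" for v a b
  proof -
    obtain \<alpha> l where a: "a = (\<alpha>, l)" by fastforce
    have arc: "(\<alpha>, l) \<in> arcs Q" using path_hd(1)[OF path] by (simp add: a)
    then have \<alpha>: "\<alpha> \<in> nontruncated_in \<Gamma> (bc_vertices \<Gamma>)" "l < val \<Gamma> \<alpha>"
      by (auto simp: arcs_Q_iff nontruncated_in_def)
    have "b = next_arrow \<Gamma> a" if C: "sublist [a, b] C" "C \<in> special_cycles \<Gamma> \<beta>" for \<beta> C
    proof -
      from C(2) have "special \<Gamma> C"
        by (auto simp: special_cycles_def special_cycle_arrow_run special_arrow_run)
      moreover obtain xs ys where "C = xs @ [a, b] @ ys"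
        using C(1) unfolding sublist_def by blast
      ultimately show ?thesis by (simp add: successively_append_iff)
    qed
    moreover have "?S \<or> ?E" if b: "b = next_arrow \<Gamma> a"
    proof (cases "val \<Gamma> \<alpha> = 1")
      case True
      then have "bc_mult \<Gamma> \<alpha> > 1"
        using full_length_gt_1[OF arc] by (simp add: full_length_def)
      then show ?thesis
        using True \<alpha>(2) b a by (auto simp: next_arrow_def)
    next
      case False
      then obtain n where n: "val \<Gamma> \<alpha> = Suc (Suc n)"
        using \<alpha>(2) by (metis One_nat_def less_nat_zero_code not0_implies_Suc)
      have "special_cycle \<Gamma> \<alpha> l = [a, b] @ arrow_run \<Gamma> (next_arrow \<Gamma> b) n"
        using special_cycle_arrow_run[OF \<alpha>(2)] b a n by simp
      then have "sublist [a, b] (special_cycle \<Gamma> \<alpha> l)"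
        unfolding sublist_def by (metis append_Nil)
      moreover have "special_cycle \<Gamma> \<alpha> l \<in> special_cycles \<Gamma> \<alpha>"
        using \<alpha>(2) by (auto simp: special_cycles_def)
      ultimately show ?thesis using \<alpha>(1) by blast
    qed
    moreover have "b = next_arrow \<Gamma> a" if "?E"
      using that by (auto simp: next_arrow_def)
    ultimately show ?thesis by blast
  qed
  show ?thesis
    unfolding relations_three_def by (intro Collect_cong ex_cong1 conj_cong refl iff)
qed

section \<open>The ideal of relations and the normal form\<close>

lemma relations_carrier:
  "relations_one K \<Gamma> \<union> relations_two K \<Gamma> \<union> relations_three K \<Gamma> \<subseteq> carrier (path_algebra K Q)"
proof -
  interpret R: ring "path_algebra K Q" by (rule Q.path_algebra_ring)
  show ?thesis
    unfolding relations_one_eq relations_two_eq relations_three_eq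
    by (auto simp: Q.path_elem_carrier arrow_run_path simp del: arrow_run.simps)
qed

lemma brauer_ideal_ideal: "ideal (brauer_ideal K \<Gamma>) (path_algebra K Q)"
proof -
  interpret R: ring "path_algebra K Q" by (rule Q.path_algebra_ring)
  show ?thesis
    unfolding brauer_ideal_def by (rule R.genideal_ideal[OF relations_carrier])
qed

lemma relations_in_brauer_ideal:
  "relations_one K \<Gamma> \<union> relations_two K \<Gamma> \<union> relations_three K \<Gamma> \<subseteq> brauer_ideal K \<Gamma>"
proof -
  interpret R: ring "path_algebra K Q" by (rule Q.path_algebra_ring)
  show ?thesis
    unfolding brauer_ideal_def by (rule R.genideal_self[OF relations_carrier])
qed

text \<open>It suffices to look at generators: type one relations are differences of paths with
  equal normal form, and type two and three relations are paths with normal form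
  \<open>None\<close>.\<close>

lemma brauer_ideal_kernel:
  fixes K :: "'k::field itself"
  shows "brauer_ideal K \<Gamma> \<subseteq> nf_kernel K"
proof -
  interpret R: ring "path_algebra K Q" by (rule Q.path_algebra_ring)
  have zero: "path_elem K x \<in> nf_kernel K" if "x \<in> paths Q" "\<not> bounded \<Gamma> (snd x)" for x
    using that by (auto simp: nf_kernel_def Q.path_elem_carrier brauer_nf_None intro: compatible_zero)
  have one: "path_elem K (V, p) \<ominus>\<^bsub>path_algebra K Q\<^esub> path_elem K (V, q) \<in> nf_kernel K"
    if "(V, p) \<in> paths Q" "full \<Gamma> p" "(V, q) \<in> paths Q" "full \<Gamma> q" for V p q
  proof -
    have "path_elem K (V, p) \<in> carrier (path_algebra K Q)" "path_elem K (V, q) \<in> carrier (path_algebra K Q)"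
      using that by (simp_all add: Q.path_elem_carrier)
    moreover from this have "pairing (path_elem K (V, p) \<ominus>\<^bsub>path_algebra K Q\<^esub> path_elem K (V, q)) \<psi>
        = \<psi> (V, p) - \<psi> (V, q)" for \<psi>
      using pairing_lincomb[of "path_elem K (V, p)" "path_elem K (V, q)" 1 "- 1" \<psi>]
      by (simp add: Q.path_algebra_minus path_algebra_simps(1))
    moreover have "\<psi> (V, p) = \<psi> (V, q)" if "compatible \<psi>" for \<psi> :: "_ \<Rightarrow> 'k"
      by (rule compatible_cong[OF that]) (simp_all add: \<open>(V, p) \<in> paths Q\<close> \<open>(V, q) \<in> paths Q\<close>
          brauer_nf_full \<open>full \<Gamma> p\<close> \<open>full \<Gamma> q\<close>)
    ultimately show ?thesis by (simp add: nf_kernel_def)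
  qed
  have "relations_one K \<Gamma> \<subseteq> nf_kernel K"
    unfolding relations_one_eq using one by blast
  moreover have "relations_two K \<Gamma> \<subseteq> nf_kernel K"
  proof
    fix x assume "x \<in> relations_two K \<Gamma>"
    then obtain a where a: "a \<in> arcs Q"
      and x: "x = path_elem K (tail Q a, arrow_run \<Gamma> a (full_length \<Gamma> (fst a) + 1))"
      unfolding relations_two_eq by blast
    have "\<not> bounded \<Gamma> (arrow_run \<Gamma> a (full_length \<Gamma> (fst a) + 1))"
      by (simp add: bounded_def del: arrow_run.simps)
    then show "x \<in> nf_kernel K"
      unfolding x using arrow_run_path(1)[OF a] by (intro zero) (simp_all del: arrow_run.simps)
  qed
  moreover have "relations_three K \<Gamma> \<subseteq> nf_kernel K"
  proof
    fix x assume "x \<in> relations_three K \<Gamma>"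
    then obtain v a b where "(v, [a, b]) \<in> paths Q" "b \<noteq> next_arrow \<Gamma> a" "x = path_elem K (v, [a, b])"
      unfolding relations_three_eq by blast
    then show "x \<in> nf_kernel K"
      using zero[of "(v, [a, b])"] by (simp add: bounded_def)
  qed
  ultimately have "relations_one K \<Gamma> \<union> relations_two K \<Gamma> \<union> relations_three K \<Gamma> \<subseteq> nf_kernel K"
    by (intro Un_least)
  then show ?thesis
    unfolding brauer_ideal_def by (rule R.genideal_minimal[OF nf_kernel_ideal])
qed

lemma path_elem_in_ideal:
  assumes I: "ideal I (path_algebra K Q)" and path: "(u, p @ m @ r) \<in> paths Q"
    and m: "path_elem K (Q.awlast u p, m) \<in> I"
  shows "path_elem K (u, p @ m @ r) \<in> I"
proof -
  interpret ideal I "path_algebra K Q" by (rule I)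
  have "path_elem K (u, p) \<in> carrier (path_algebra K Q)"
    "path_elem K (Q.awlast (Q.awlast u p) m, r) \<in> carrier (path_algebra K Q)"
    using path by (simp_all add: Q.path_elem_carrier Q.paths_append_iff)
  then have "path_elem K (u, p) \<otimes>\<^bsub>path_algebra K Q\<^esub> (path_elem K (Q.awlast u p, m) \<otimes>\<^bsub>path_algebra K Q\<^esub>
      path_elem K (Q.awlast (Q.awlast u p) m, r)) \<in> I"
    using m by (intro I_l_closed I_r_closed)
  then show ?thesis by (simp add: Q.path_elem_mult)
qed

text \<open>A special path that is too long begins with a type two relation. A path that is not
  special contains two consecutive arrows forming a type three relation. Multiplying by the
  remaining pieces gives the whole path.\<close>

lemma unbounded_in_brauer_ideal:
  assumes path: "(u, p) \<in> paths Q" and "\<not> bounded \<Gamma> p"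
  shows "path_elem K (u, p) \<in> brauer_ideal K \<Gamma>"
proof (cases "special \<Gamma> p")
  case True
  with assms(2) have p: "p \<noteq> []" "length p > full_length \<Gamma> (fst (hd p))"
    by (auto simp: bounded_def)
  define a where "a = hd p"
  have a: "a \<in> arcs Q" "tail Q a = u" using path_hd[OF path p(1)] by (simp_all add: a_def)
  obtain k where k: "length p = (full_length \<Gamma> (fst a) + 1) + k"
    using p(2) by (metis Suc_eq_plus1 a_def less_iff_Suc_add add_Suc_right add_Suc)
  have "p = [] @ arrow_run \<Gamma> a (full_length \<Gamma> (fst a) + 1) @
      arrow_run \<Gamma> ((next_arrow \<Gamma> ^^ (full_length \<Gamma> (fst a) + 1)) a) k"
    using special_imp_arrow_run[OF True p(1)] unfolding a_def[symmetric] k arrow_run_add by simp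
  moreover have "path_elem K (tail Q a, arrow_run \<Gamma> a (full_length \<Gamma> (fst a) + 1)) \<in> brauer_ideal K \<Gamma>"
    using relations_in_brauer_ideal[of K] a(1) unfolding relations_two_eq by blast
  then have "path_elem K (Q.awlast u [], arrow_run \<Gamma> a (full_length \<Gamma> (fst a) + 1)) \<in> brauer_ideal K \<Gamma>"
    using a(2) by (simp del: arrow_run.simps)
  ultimately show ?thesis
    using path_elem_in_ideal[OF brauer_ideal_ideal] path by metis
next
  case False
  then obtain q a b r where p: "p = q @ [a, b] @ r" "b \<noteq> next_arrow \<Gamma> a"
    using not_successively_split by blast
  have "(Q.awlast u q, [a, b]) \<in> paths Q"
    using path unfolding p(1) Q.paths_append_iff by blast
  then have "path_elem K (Q.awlast u q, [a, b]) \<in> brauer_ideal K \<Gamma>"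
    using relations_in_brauer_ideal[of K] p(2) unfolding relations_three_eq by blast
  then show ?thesis
    using path_elem_in_ideal[OF brauer_ideal_ideal path[unfolded p(1)]] unfolding p(1) by blast
qed

lemma brauer_ideal_reduce:
  assumes x: "x \<in> paths Q"
  shows "case brauer_nf x of None \<Rightarrow> path_elem K x \<in> brauer_ideal K \<Gamma>
    | Some y \<Rightarrow> path_elem K x \<ominus>\<^bsub>path_algebra K Q\<^esub> path_elem K y \<in> brauer_ideal K \<Gamma>"
proof -
  interpret ideal "brauer_ideal K \<Gamma>" "path_algebra K Q" by (rule brauer_ideal_ideal)
  obtain u p where up: "x = (u, p)" by fastforce
  have u: "u \<in> bc_polygons \<Gamma>" using x Q.paths_start by (auto simp: up)
  consider "\<not> bounded \<Gamma> p" | "full \<Gamma> p" | "bounded \<Gamma> p" "\<not> full \<Gamma> p" by blast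
  then show ?thesis
  proof cases
    case 1
    then show ?thesis
      using unbounded_in_brauer_ideal[of u p K] x by (simp add: up brauer_nf_def)
  next
    case 2
    then have "path_elem K (u, p) \<ominus>\<^bsub>path_algebra K Q\<^esub> path_elem K (u, socle_path u) \<in> brauer_ideal K \<Gamma>"
      using relations_in_brauer_ideal[of K] x[unfolded up] socle_path[OF u] unfolding relations_one_eq by blast
    then show ?thesis
      using 2 by (simp add: up brauer_nf_full)
  next
    case 3
    have "path_elem K x \<in> carrier (path_algebra K Q)" using x by (simp add: Q.path_elem_carrier)
    then have "path_elem K x \<ominus>\<^bsub>path_algebra K Q\<^esub> path_elem K x = \<zero>\<^bsub>path_algebra K Q\<^esub>"
      by (simp add: minus_eq r_neg)
    then show ?thesis
      using 3 by (simp add: up brauer_nf_def)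
  qed
qed

text \<open>The entry at (v, w) is the dimension of w \<Lambda> v and paths compose from left to
  right, hence the order \<open>W V\<close>. The trivial path at \<open>W\<close> is bounded, which
  keeps the quotient nonzero.\<close>

lemma brauer_cartan_matrix_eq:
  assumes "V \<in> bc_polygons \<Gamma>" "W \<in> bc_polygons \<Gamma>" "finite (normal_paths W V)"
  shows "brauer_cartan_matrix K \<Gamma> V W = card (normal_paths W V)"
  unfolding brauer_cartan_matrix_def brauer_algebra_def brauer_scalars_def brauer_class_def
  by (rule cartan_matrix_quotient[OF brauer_ideal_ideal brauer_ideal_kernel brauer_ideal_reduce])
    (use assms in \<open>simp_all add: brauer_nf_def bounded_def full_def\<close>)

end

section \<open>Counting normal paths\<close>

text \<open>Raising the shift by one trades the summand at 0 for the one at \<open>n\<close>. The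
  two agree modulo \<open>n\<close>, and comparing both ways of splitting the sum up to
  \<open>n\<close> cancels them.\<close>

lemma sum_mod_shift:
  fixes f :: "nat \<Rightarrow> 'c::cancel_comm_monoid_add"
  shows "(\<Sum>m<n. f ((l + m) mod n)) = (\<Sum>j<n. f j)"
proof (induction l)
  case (Suc l)
  let ?g = "\<lambda>m. f ((l + m) mod n)"
  have "?g 0 + (\<Sum>m<n. ?g (Suc m)) = (\<Sum>m<Suc n. ?g m)"
    by (rule sum.lessThan_Suc_shift[symmetric])
  also have "\<dots> = ?g 0 + (\<Sum>m<n. ?g m)"
    by (simp add: add.commute)
  finally have "(\<Sum>m<n. ?g (Suc m)) = (\<Sum>m<n. ?g m)" by simp
  then show ?case using Suc by simp
qed simp

lemma sum_lessThan_add: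
  fixes g :: "nat \<Rightarrow> 'c::comm_monoid_add"
  shows "(\<Sum>m<a + b. g m) = (\<Sum>m<a. g m) + (\<Sum>m<b. g (a + m))"
  by (induction b) (simp_all add: add.assoc)

lemma sum_mod_periods:
  fixes f :: "nat \<Rightarrow> 'c::comm_semiring_1_cancel"
  shows "(\<Sum>m<k * n. f ((l + m) mod n)) = of_nat k * (\<Sum>j<n. f j)"
proof (induction k)
  case (Suc k)
  have "(\<Sum>m<Suc k * n. f ((l + m) mod n)) = (\<Sum>m<k * n + n. f ((l + m) mod n))"
    by (simp add: add.commute)
  also have "\<dots> = (\<Sum>m<k * n. f ((l + m) mod n)) + (\<Sum>m<n. f ((l + (k * n + m)) mod n))"
    by (rule sum_lessThan_add)
  also have "(\<Sum>m<n. f ((l + (k * n + m)) mod n)) = (\<Sum>m<n. f ((l + m) mod n))"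
    by (intro sum.cong refl arg_cong[where f = f]) (metis add.left_commute mod_mult_self2 mult.commute add.commute)
  finally have "(\<Sum>m<Suc k * n. f ((l + m) mod n)) = of_nat k * sum f {..<n} + sum f {..<n}"
    unfolding Suc sum_mod_shift .
  then show ?case by (simp only: of_nat_Suc distrib_right mult_1_left add.commute)
qed simp

section \<open>Counting runs between two polygons\<close>

context brauer_configuration
begin

lemma occ_eq_card:
  assumes "\<alpha> \<in> bc_vertices \<Gamma>" "\<not> truncated \<Gamma> \<alpha>" "V \<in> bc_polygons \<Gamma>"
  shows "card {l. l < val \<Gamma> \<alpha> \<and> bc_succ \<Gamma> \<alpha> ! l = V} = occ \<Gamma> \<alpha> V"
proof -
  have "occ \<Gamma> \<alpha> V = count (mset (bc_succ \<Gamma> \<alpha>)) V"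
    using assms by (simp add: orientation)
  also have "\<dots> = card {l. l < length (bc_succ \<Gamma> \<alpha>) \<and> V = bc_succ \<Gamma> \<alpha> ! l}"
    by (simp add: count_mset count_list_eq_length_filter length_filter_conv_card)
  finally show ?thesis
    using assms by (simp add: length_succ eq_commute)
qed

text \<open>In \<open>bc_mult\<close> full turns every position of the successor list is met equally
  often, which gives the product. Length 0 is then removed, and it is a solution exactly when the
  run starts at \<open>V\<close>; otherwise the trivial path would be counted once for every
  starting arrow.\<close>

lemma card_run_lengths:
  assumes "\<alpha> \<in> bc_vertices \<Gamma>" "\<not> truncated \<Gamma> \<alpha>" "V \<in> bc_polygons \<Gamma>"
    and l: "l < val \<Gamma> \<alpha>"
  shows "card {m \<in> {1..<full_length \<Gamma> \<alpha>}. bc_succ \<Gamma> \<alpha> ! ((l + m) mod val \<Gamma> \<alpha>) = V} =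
    bc_mult \<Gamma> \<alpha> * occ \<Gamma> \<alpha> V - (if bc_succ \<Gamma> \<alpha> ! l = V then 1 else 0)"
proof -
  let ?n = "val \<Gamma> \<alpha>" and ?P = "\<lambda>j. bc_succ \<Gamma> \<alpha> ! j = V"
  let ?M = "{m. m < full_length \<Gamma> \<alpha> \<and> ?P ((l + m) mod ?n)}"
  have pos: "full_length \<Gamma> \<alpha> > 0"
    using full_length_gt_1[of "(\<alpha>, l)"] assms by (simp add: arcs_Q_iff)
  have "card ?M = (\<Sum>m<bc_mult \<Gamma> \<alpha> * ?n. if ?P ((l + m) mod ?n) then 1 else 0)"
    by (simp add: sum.If_cases full_length_def lessThan_def Collect_conj_eq)
  also have "\<dots> = bc_mult \<Gamma> \<alpha> * (\<Sum>j<?n. if ?P j then 1 else 0)"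
    by (subst sum_mod_periods) simp
  also have "(\<Sum>j<?n. if ?P j then 1 else 0) = card {j. j < ?n \<and> ?P j}"
    by (simp add: sum.If_cases lessThan_def Collect_conj_eq)
  finally have M: "card ?M = bc_mult \<Gamma> \<alpha> * occ \<Gamma> \<alpha> V"
    using occ_eq_card[OF assms(1-3)] by simp
  have "{m \<in> {1..<full_length \<Gamma> \<alpha>}. ?P ((l + m) mod ?n)} = ?M - {0}" by auto
  moreover have "0 \<in> ?M \<longleftrightarrow> ?P l" using pos l by simp
  ultimately show ?thesis
    using M by (simp add: card_Diff_singleton_if)
qed

definition run_indices :: "'p \<Rightarrow> 'p \<Rightarrow> ('a \<times> nat \<times> nat) set" where
  "run_indices W V = Sigma {\<alpha> \<in> bc_vertices \<Gamma>. \<not> truncated \<Gamma> \<alpha>}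
    (\<lambda>\<alpha>. Sigma {l. l < val \<Gamma> \<alpha> \<and> bc_succ \<Gamma> \<alpha> ! l = W}
      (\<lambda>l. {m \<in> {1..<full_length \<Gamma> \<alpha>}. bc_succ \<Gamma> \<alpha> ! ((l + m) mod val \<Gamma> \<alpha>) = V}))"

lemma finite_run_indices: "finite (run_indices W V)"
  unfolding run_indices_def by (intro finite_SigmaI) (auto simp: finite_vertices)

text \<open>The number of admissible lengths depends on the start only through the polygon
  \<open>W\<close>, so it is multiplied by the number of arrows of \<alpha> that leave
  \<open>W\<close>.\<close>

lemma card_run_indices:
  assumes "V \<in> bc_polygons \<Gamma>" "W \<in> bc_polygons \<Gamma>"
  shows "card (run_indices W V) = (\<Sum>\<alpha>\<in>{\<alpha> \<in> bc_vertices \<Gamma>. \<not> truncated \<Gamma> \<alpha>}.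
    occ \<Gamma> \<alpha> W * (bc_mult \<Gamma> \<alpha> * occ \<Gamma> \<alpha> V - (if V = W then 1 else 0)))"
proof -
  have "card (run_indices W V) = (\<Sum>\<alpha>\<in>{\<alpha> \<in> bc_vertices \<Gamma>. \<not> truncated \<Gamma> \<alpha>}.
      \<Sum>l\<in>{l. l < val \<Gamma> \<alpha> \<and> bc_succ \<Gamma> \<alpha> ! l = W}.
      card {m \<in> {1..<full_length \<Gamma> \<alpha>}. bc_succ \<Gamma> \<alpha> ! ((l + m) mod val \<Gamma> \<alpha>) = V})"
    unfolding run_indices_def
    by (subst card_SigmaI) (auto simp: finite_vertices intro!: sum.cong card_SigmaI finite_SigmaI)
  also have "\<dots> = (\<Sum>\<alpha>\<in>{\<alpha> \<in> bc_vertices \<Gamma>. \<not> truncated \<Gamma> \<alpha>}.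
      \<Sum>l\<in>{l. l < val \<Gamma> \<alpha> \<and> bc_succ \<Gamma> \<alpha> ! l = W}.
      bc_mult \<Gamma> \<alpha> * occ \<Gamma> \<alpha> V - (if V = W then 1 else 0))"
  proof (intro sum.cong refl)
    fix \<alpha> l assume \<alpha>: "\<alpha> \<in> {\<alpha> \<in> bc_vertices \<Gamma>. \<not> truncated \<Gamma> \<alpha>}"
      and "l \<in> {l. l < val \<Gamma> \<alpha> \<and> bc_succ \<Gamma> \<alpha> ! l = W}"
    then have l: "l < val \<Gamma> \<alpha>" "bc_succ \<Gamma> \<alpha> ! l = W" by auto
    have "card {m \<in> {1..<full_length \<Gamma> \<alpha>}. bc_succ \<Gamma> \<alpha> ! ((l + m) mod val \<Gamma> \<alpha>) = V} =
        bc_mult \<Gamma> \<alpha> * occ \<Gamma> \<alpha> V - (if bc_succ \<Gamma> \<alpha> ! l = V then 1 else 0)"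
      using \<alpha> assms(1) l(1) by (intro card_run_lengths) auto
    then show "card {m \<in> {1..<full_length \<Gamma> \<alpha>}. bc_succ \<Gamma> \<alpha> ! ((l + m) mod val \<Gamma> \<alpha>) = V} =
        bc_mult \<Gamma> \<alpha> * occ \<Gamma> \<alpha> V - (if V = W then 1 else 0)"
      by (simp only: l(2) eq_commute[of W V])
  qed
  also have "\<dots> = (\<Sum>\<alpha>\<in>{\<alpha> \<in> bc_vertices \<Gamma>. \<not> truncated \<Gamma> \<alpha>}.
      occ \<Gamma> \<alpha> W * (bc_mult \<Gamma> \<alpha> * occ \<Gamma> \<alpha> V - (if V = W then 1 else 0)))"
    using assms by (intro sum.cong refl) (simp add: occ_eq_card)
  finally show ?thesis .
qed

text \<open>A path equal to its normal form is trivial, the chosen socle path, or a nonempty run of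
  smaller length. The first two are closed and hence appear only for \<open>V = W\<close>.\<close>

lemma normal_paths_eq:
  assumes "V \<in> bc_polygons \<Gamma>" "W \<in> bc_polygons \<Gamma>"
  shows "normal_paths W V = (if V = W then {(W, []), (W, socle_path W)} else {}) \<union>
    (\<lambda>(\<alpha>, l, m). (W, arrow_run \<Gamma> (\<alpha>, l) m)) ` run_indices W V" (is "_ = ?T \<union> ?S")
proof (intro equalityI subsetI)
  fix x assume "x \<in> normal_paths W V"
  then obtain p where x: "x = (W, p)" "(W, p) \<in> paths Q" "Q.awlast W p = V"
    and nf: "brauer_nf (W, p) = Some (W, p)"
    by (auto simp: normal_paths_def)
  consider "p = []" | "full \<Gamma> p" | "p \<noteq> []" "\<not> full \<Gamma> p" by blast
  then show "x \<in> ?T \<union> ?S"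
  proof cases
    case 1
    then show ?thesis using x by auto
  next
    case 2
    then have "p = socle_path W" using nf by (simp add: brauer_nf_full)
    then show ?thesis using full_path(1)[OF x(2) 2] x by auto
  next
    case 3
    have b: "bounded \<Gamma> p" using nf by (auto simp: brauer_nf_def split: if_splits)
    obtain \<alpha> l where h: "hd p = (\<alpha>, l)" by fastforce
    have s: "special \<Gamma> p" "length p < full_length \<Gamma> \<alpha>"
      using b 3 h by (auto simp: bounded_def full_def)
    have a: "(\<alpha>, l) \<in> arcs Q" "tail Q (\<alpha>, l) = W"
      using path_hd[OF x(2) 3(1)] by (simp_all add: h)
    have p: "p = arrow_run \<Gamma> (\<alpha>, l) (length p)"
      using special_imp_arrow_run[OF s(1) 3(1)] h by simp
    have l: "l < val \<Gamma> \<alpha>" using a(1) by (simp add: arcs_Q_iff)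
    have "tail Q ((next_arrow \<Gamma> ^^ length p) (\<alpha>, l)) = V"
      using arrow_run_path(2)[OF a(1), of "length p"] p x(3) a(2) by simp
    then have "(\<alpha>, l, length p) \<in> run_indices W V"
      using a s(2) 3(1) l
      by (auto simp: run_indices_def arcs_Q_iff tail_Q funpow_next_arrow Suc_le_eq)
    then show ?thesis using p x(1) by (auto intro!: rev_image_eqI)
  qed
next
  fix x assume "x \<in> ?T \<union> ?S"
  then consider "x \<in> ?T" | \<alpha> l m where "(\<alpha>, l, m) \<in> run_indices W V" "x = (W, arrow_run \<Gamma> (\<alpha>, l) m)"
    by auto
  then show "x \<in> normal_paths W V"
  proof cases
    case 1
    moreover have "(W, []) \<in> normal_paths W W"
      using assms by (simp add: normal_paths_def brauer_nf_def bounded_def full_def)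
    moreover have "(W, socle_path W) \<in> normal_paths W W"
      using socle_path[OF assms(2)] full_path(1)[OF socle_path[OF assms(2)]]
      by (simp add: normal_paths_def brauer_nf_full)
    ultimately show ?thesis by (auto split: if_splits)
  next
    case 2
    then have \<alpha>: "(\<alpha>, l) \<in> arcs Q" "tail Q (\<alpha>, l) = W" "l < val \<Gamma> \<alpha>" "0 < m" "m < full_length \<Gamma> \<alpha>"
      and V: "tail Q ((next_arrow \<Gamma> ^^ m) (\<alpha>, l)) = V"
      by (auto simp: run_indices_def arcs_Q_iff tail_Q funpow_next_arrow)
    have "bounded \<Gamma> (arrow_run \<Gamma> (\<alpha>, l) m)" "\<not> full \<Gamma> (arrow_run \<Gamma> (\<alpha>, l) m)"
      using \<alpha> by (simp_all add: bounded_def full_def special_arrow_run)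
    then show ?thesis
      using arrow_run_path[OF \<alpha>(1), of m] \<alpha>(2) V 2(2) by (simp add: normal_paths_def brauer_nf_def)
  qed
qed

lemma finite_normal_paths:
  assumes "V \<in> bc_polygons \<Gamma>" "W \<in> bc_polygons \<Gamma>"
  shows "finite (normal_paths W V)"
  unfolding normal_paths_eq[OF assms] by (simp add: finite_run_indices)

text \<open>The first arrow and the length recover a nonempty run, so the indexing is injective.
  Indexed runs are neither empty nor full, and the socle path is full, so nothing is counted
  twice.\<close>

lemma card_normal_paths:
  assumes "V \<in> bc_polygons \<Gamma>" "W \<in> bc_polygons \<Gamma>"
  shows "card (normal_paths W V) = (if V = W then 2 else 0) + card (run_indices W V)"
proof -
  let ?T = "if V = W then {(W, []), (W, socle_path W)} else {}"
  let ?f = "\<lambda>(\<alpha>, l, m). (W, arrow_run \<Gamma> (\<alpha>, l) m)"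
  have m: "0 < m \<and> m < full_length \<Gamma> \<alpha>" if "(\<alpha>, l, m) \<in> run_indices W V" for \<alpha> l m
    using that by (auto simp: run_indices_def)
  have inj: "inj_on ?f (run_indices W V)"
  proof (rule inj_onI)
    fix x y assume xy: "x \<in> run_indices W V" "y \<in> run_indices W V" "?f x = ?f y"
    obtain \<alpha> l m \<beta> k n where x: "x = (\<alpha>, l, m)" and y: "y = (\<beta>, k, n)" by (metis prod_cases3)
    have eq: "arrow_run \<Gamma> (\<alpha>, l) m = arrow_run \<Gamma> (\<beta>, k) n" using xy(3) by (simp add: x y)
    have pos: "0 < m" "0 < n" using m xy(1,2) by (auto simp: x y)
    have "m = n" using arg_cong[OF eq, of length] by simp
    moreover have "(\<alpha>, l) = (\<beta>, k)" using arg_cong[OF eq, of hd] pos by simp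
    ultimately show "x = y" by (simp add: x y)
  qed
  have nonfull: "p \<noteq> [] \<and> \<not> full \<Gamma> p" if "(W, p) \<in> ?f ` run_indices W V" for p
  proof -
    from that obtain \<alpha> l k where k: "(\<alpha>, l, k) \<in> run_indices W V" and p: "p = arrow_run \<Gamma> (\<alpha>, l) k"
      by auto
    show ?thesis using m[OF k] by (auto simp: p full_def)
  qed
  have ne: "socle_path W \<noteq> []" "full \<Gamma> (socle_path W)"
    using socle_path(2)[OF assms(2)] by (auto simp: full_def)
  have "(W, []) \<notin> ?f ` run_indices W V" "(W, socle_path W) \<notin> ?f ` run_indices W V"
    using nonfull ne by blast+
  then have "?T \<inter> ?f ` run_indices W V = {}"
    by (cases "V = W") (simp_all add: Int_insert_left)
  then have "card (normal_paths W V) = card ?T + card (?f ` run_indices W V)"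
    unfolding normal_paths_eq[OF assms] by (intro card_Un_disjoint) (simp_all add: finite_run_indices)
  also have "card ?T = (if V = W then 2 else 0)"
    using ne by auto
  finally show ?thesis by (simp only: card_image[OF inj])
qed

section \<open>The entries of the Cartan matrix\<close>

lemma occ_le_val: "V \<in> bc_polygons \<Gamma> \<Longrightarrow> occ \<Gamma> \<alpha> V \<le> val \<Gamma> \<alpha>"
  unfolding val_def by (rule member_le_sum) (simp_all add: finite_polygons)

lemma occ_add_occ_le_val:
  assumes "V \<in> bc_polygons \<Gamma>" "W \<in> bc_polygons \<Gamma>" "V \<noteq> W"
  shows "occ \<Gamma> \<alpha> V + occ \<Gamma> \<alpha> W \<le> val \<Gamma> \<alpha>"
proof -
  have "(\<Sum>U\<in>{V, W}. occ \<Gamma> \<alpha> U) \<le> val \<Gamma> \<alpha>"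
    unfolding val_def using assms by (intro sum_mono2 finite_polygons) auto
  then show ?thesis using assms(3) by simp
qed

lemma occ_pos_iff: "occ \<Gamma> \<alpha> V > 0 \<longleftrightarrow> \<alpha> \<in> polygon_vertices \<Gamma> V"
  by (simp add: occ_def)

text \<open>Both index sets are compared with \<open>bc_vertices \<Gamma>\<close>. A truncated
  vertex occurs at most once in \<open>V\<close> and has multiplicity 1, so its summand is 0; a
  vertex outside \<open>V\<close> has \<open>occ\<close> equal to 0.\<close>

lemma cartan_entry_diagonal:
  assumes V: "V \<in> bc_polygons \<Gamma>"
  shows "int (card (run_indices V V)) = (\<Sum>\<alpha>\<in>polygon_vertices \<Gamma> V.
    int (occ \<Gamma> \<alpha> V) * (int (occ \<Gamma> \<alpha> V) * int (bc_mult \<Gamma> \<alpha>) - 1))"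
proof -
  let ?N = "{\<alpha> \<in> bc_vertices \<Gamma>. \<not> truncated \<Gamma> \<alpha>}"
  let ?g = "\<lambda>\<alpha>. int (occ \<Gamma> \<alpha> V) * (int (occ \<Gamma> \<alpha> V) * int (bc_mult \<Gamma> \<alpha>) - 1)"
  have "int (card (run_indices V V)) = (\<Sum>\<alpha>\<in>?N. ?g \<alpha>)"
    unfolding card_run_indices[OF V V] of_nat_sum
  proof (intro sum.cong refl)
    fix \<alpha> assume "\<alpha> \<in> ?N"
    then have mu: "bc_mult \<Gamma> \<alpha> > 0" using mult_pos by simp
    show "int (occ \<Gamma> \<alpha> V * (bc_mult \<Gamma> \<alpha> * occ \<Gamma> \<alpha> V - (if V = V then 1 else 0))) = ?g \<alpha>"
    \<comment> \<open>The count subtracts natural numbers, the formula integers. They agree if the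
      product is positive; otherwise the natural difference is cut off at 0, but then the outer
      factor \<open>occ\<close> vanishes.\<close>
    proof (cases "occ \<Gamma> \<alpha> V = 0")
      case False
      then have "bc_mult \<Gamma> \<alpha> * occ \<Gamma> \<alpha> V \<ge> 1" using mu by (simp add: Suc_le_eq)
      then show ?thesis by (simp add: of_nat_diff mult.commute)
    qed simp
  qed
  also have "\<dots> = (\<Sum>\<alpha>\<in>bc_vertices \<Gamma>. ?g \<alpha>)"
  proof (intro sum.mono_neutral_left finite_vertices ballI)
    fix \<alpha> assume "\<alpha> \<in> bc_vertices \<Gamma> - ?N"
    then have t: "val \<Gamma> \<alpha> = 1" "bc_mult \<Gamma> \<alpha> = 1" by (auto simp: truncated_def)
    then have "occ \<Gamma> \<alpha> V = 0 \<or> occ \<Gamma> \<alpha> V = 1" using occ_le_val[OF V, of \<alpha>] by linarith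
    then show "?g \<alpha> = 0" using t by auto
  qed auto
  also have "\<dots> = (\<Sum>\<alpha>\<in>polygon_vertices \<Gamma> V. ?g \<alpha>)"
    using polygon_vertices_subset[OF V]
    by (intro sum.mono_neutral_right finite_vertices) (auto simp: occ_def not_in_iff)
  finally show ?thesis .
qed

text \<open>A vertex shared by two different polygons has valency at least 2 and so is not
  truncated. For every other nontruncated vertex one of the two occurrence numbers is 0.\<close>

lemma cartan_entry_off_diagonal:
  assumes V: "V \<in> bc_polygons \<Gamma>" and W: "W \<in> bc_polygons \<Gamma>" and "V \<noteq> W"
  shows "int (card (run_indices W V)) =
    (\<Sum>\<alpha>\<in>polygon_vertices \<Gamma> V \<inter> polygon_vertices \<Gamma> W.
      int (bc_mult \<Gamma> \<alpha>) * int (occ \<Gamma> \<alpha> V) * int (occ \<Gamma> \<alpha> W))"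
proof -
  let ?N = "{\<alpha> \<in> bc_vertices \<Gamma>. \<not> truncated \<Gamma> \<alpha>}"
  let ?g = "\<lambda>\<alpha>. int (bc_mult \<Gamma> \<alpha>) * int (occ \<Gamma> \<alpha> V) * int (occ \<Gamma> \<alpha> W)"
  have "int (card (run_indices W V)) = (\<Sum>\<alpha>\<in>?N. ?g \<alpha>)"
    unfolding card_run_indices[OF V W] of_nat_sum using \<open>V \<noteq> W\<close> by (intro sum.cong refl) simp
  also have "\<dots> = (\<Sum>\<alpha>\<in>polygon_vertices \<Gamma> V \<inter> polygon_vertices \<Gamma> W. ?g \<alpha>)"
  proof (rule sum.mono_neutral_right)
    show "polygon_vertices \<Gamma> V \<inter> polygon_vertices \<Gamma> W \<subseteq> ?N"
    proof
      fix \<alpha> assume \<alpha>: "\<alpha> \<in> polygon_vertices \<Gamma> V \<inter> polygon_vertices \<Gamma> W"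
      then have "occ \<Gamma> \<alpha> V > 0" "occ \<Gamma> \<alpha> W > 0" unfolding occ_pos_iff by auto
      then have "val \<Gamma> \<alpha> \<noteq> 1" using occ_add_occ_le_val[OF assms, of \<alpha>] by linarith
      then show "\<alpha> \<in> ?N" using \<alpha> polygon_vertices_subset[OF V] by (auto simp: truncated_def)
    qed
  qed (auto simp: finite_vertices occ_def not_in_iff)
  finally show ?thesis .
qed

end

theorem proposition3p3:
  fixes K :: "'k :: alg_closed_field itself"
    and \<Gamma> :: "('a, 'p) brauer_config"
    and V W :: 'p
  assumes "brauer_configuration \<Gamma>"
    and "V \<in> bc_polygons \<Gamma>" and "W \<in> bc_polygons \<Gamma>"
  shows "int (brauer_cartan_matrix K \<Gamma> V W) =
    (if V = W
     then 2 + (\<Sum>\<alpha>\<in>polygon_vertices \<Gamma> V.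
            int (occ \<Gamma> \<alpha> V) * (int (occ \<Gamma> \<alpha> V) * int (bc_mult \<Gamma> \<alpha>) - 1))
     else (\<Sum>\<alpha>\<in>polygon_vertices \<Gamma> V \<inter> polygon_vertices \<Gamma> W.
            int (bc_mult \<Gamma> \<alpha>) * int (occ \<Gamma> \<alpha> V) * int (occ \<Gamma> \<alpha> W)))"
proof -
  interpret brauer_configuration \<Gamma> by (rule assms(1))
  have "brauer_cartan_matrix K \<Gamma> V W = (if V = W then 2 else 0) + card (run_indices W V)"
    unfolding card_normal_paths[OF assms(2,3), symmetric]
    by (rule brauer_cartan_matrix_eq[OF assms(2,3) finite_normal_paths[OF assms(2,3)]])
  then show ?thesis
    using cartan_entry_diagonal[OF assms(2)] cartan_entry_off_diagonal[OF assms(2,3)] by auto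
qed

end
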